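(* Let $C$ be a 3-rotationally symmetric planar convex body of unit area, and let $\widetilde{H}$ be the unit-area set described in the context. Then $$d_M(T_b,\widetilde{H})\leq d_M(T_b,C),$$ where in each case $T_b$ denotes the standard trisection of the corresponding set, with equality if and only if $C$ coincides with $\widetilde{H}$ up to a rigid motion of the plane.
   Context: A planar convex body is a compact convex subset of the Euclidean plane with nonempty interior; $d$ is the Euclidean distance. $C$ is 3-rotationally symmetric if there is a center $p\in C$ such that $C$ is invariant under the rotation of angle $120$ degrees about $p$. Standard trisection: let $T_r(C)$ be the smallest equilateral triangle containing $C$, constructed as follows: choose $m\in\partial C$ with $d(p,m)=d(p,\partial C)$ (any such $m$ if there are several), take the line through $m$ orthogonal to the segment $\overline{pm}$, and its images under the rotations of $120$ and $240$ degrees about $p$; these three lines bound $T_r(C)$. The midpoints $v_1,v_2,v_3$ of the edges of $T_r(C)$ lie on $\partial C$. The standard trisection $T_b=T_b(C)$ is the decomposition of $C$ into three closed subsets $C_1,C_2,C_3$ (identical up to rotation) by the three line segments joining $p$ to $v_1,v_2,v_3$; its endpoints are $v_1,v_2,v_3$. Maximum relative diameter: $d_M(T_b,C)=\max\{D(C_1),D(C_2),D(C_3)\}$, where $D(C_i)=\max\{d(x,y):x,y\in C_i\}$. The set $\widetilde{H}$: for $a\in[0,2^{1/2}3^{-3/4}]$ let $b=-2a+\sqrt{4\cdot 3^{-1/2}+3a^2}$ and let $H_\varepsilon$ be the unit-area hexagon (with edges of lengths $a,b$ alternately) obtained from an equilateral triangle with edges of length $b+2a$ by removing from its corners three equilateral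 triangles with edges of length $a$. Its center of symmetry is the center $p$ of the triangle, and for any vertex $x$ of $H_\varepsilon$ and two endpoints $v_1,v_2$ of $T_b(H_\varepsilon)$ (midpoints of edges of the equilateral triangle), $$d(p,x)=\tfrac13\Big(4\sqrt3+18a^2-3a\sqrt{12\sqrt3+27a^2}\Big)^{1/2},\qquad d(v_1,v_2)=\tfrac12\Big(3a^2+4/\sqrt3\Big)^{1/2}.$$ Let $a_0=0.141227\dots$ be the value of $a$ for which these two quantities are equal. For $H_\varepsilon$ with $a=a_0$, set $r=d(p,x)$ with $x$ any vertex, and replace the three edges of length $a_0$ by the circular arcs of radius $r$ centered at $p$ joining their endpoints. The set $\widetilde{H}$ is the dilate of the resulting 3-rotationally symmetric convex body having unit area. *)

theory Defs
  imports "HOL-Analysis.Analysis"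
begin

text \<open>The Euclidean plane is the type \<^typ>\<open>complex\<close>, with its library metric, inner product
  and Lebesgue measure.\<close>

section \<open>Bodies, rotations and rigid motions\<close>

definition planar_convex_body :: "complex set \<Rightarrow> bool" where
  "planar_convex_body C \<longleftrightarrow> compact C \<and> convex C \<and> interior C \<noteq> {}"

definition rotation :: "complex \<Rightarrow> real \<Rightarrow> complex \<Rightarrow> complex" where
  "rotation p \<theta> z = p + cis \<theta> * (z - p)"

definition rot3_center :: "complex set \<Rightarrow> complex \<Rightarrow> bool" where
  "rot3_center C p \<longleftrightarrow> p \<in> C \<and> rotation p (2 * pi / 3) ` C = C"

definition rot3_symmetric :: "complex set \<Rightarrow> bool" where
  "rot3_symmetric C \<longleftrightarrow> (\<exists>p. rot3_center C p)"

definition rigid_motion :: "(complex \<Rightarrow> complex) \<Rightarrow> bool" where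
  "rigid_motion f \<longleftrightarrow> (\<forall>x y. dist (f x) (f y) = dist x y)"

section \<open>The standard trisection\<close>

text \<open>The line through \<open>m\<close> orthogonal to the segment \<open>pm\<close>, rotated about \<open>p\<close> by \<open>k\<close> times
  120 degrees.\<close>

definition bounding_line :: "complex \<Rightarrow> complex \<Rightarrow> nat \<Rightarrow> complex set" where
  "bounding_line p m k =
     rotation p (2 * pi * real k / 3) ` {z. inner (z - m) (m - p) = 0}"

definition bounding_triangle :: "complex \<Rightarrow> complex \<Rightarrow> complex set" where
  "bounding_triangle p m =
     convex hull {z. \<exists>j<3. \<exists>k<3. j \<noteq> k \<and> z \<in> bounding_line p m j \<inter> bounding_line p m k}"

definition trisection_endpoints :: "complex \<Rightarrow> complex \<Rightarrow> complex set" where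
  "trisection_endpoints p m =
     {midpoint x y |x y. closed_segment x y edge_of bounding_triangle p m}"

text \<open>Cutting \<open>C\<close> along the three segments leaves relatively open pieces; the closed subsets of
  the decomposition are their closures.\<close>

definition trisection :: "complex set \<Rightarrow> complex \<Rightarrow> complex \<Rightarrow> complex set set" where
  "trisection C p m =
     closure ` components (C - (\<Union>v\<in>trisection_endpoints p m. closed_segment p v))"

text \<open>A relation rather than a function, because the nearest boundary point \<open>m\<close> need not be
  unique.\<close>

definition standard_trisection :: "complex set \<Rightarrow> complex set set \<Rightarrow> bool" where
  "standard_trisection C T \<longleftrightarrow>
     (\<exists>p m. rot3_center C p \<and> m \<in> frontier C \<and> dist p m = infdist p (frontier C) \<and>
            T = trisection C p m)"

definition max_rel_diameter :: "complex set set \<Rightarrow> real" where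
  "max_rel_diameter T = Max (diameter ` T)"

section \<open>The optimal body\<close>

definition hex_b :: "real \<Rightarrow> real" where
  "hex_b a = - 2 * a + sqrt (4 / sqrt 3 + 3 * a\<^sup>2)"

text \<open>Vertices of the equilateral triangle with edge length \<open>b + 2a\<close> centred at the origin; the
  index is read modulo 3.\<close>

definition tri_vertex :: "real \<Rightarrow> nat \<Rightarrow> complex" where
  "tri_vertex a k = ((hex_b a + 2 * a) / sqrt 3) *\<^sub>R cis (2 * pi * real k / 3)"

definition tri :: "real \<Rightarrow> complex set" where
  "tri a = convex hull (tri_vertex a ` {..<3})"

text \<open>The point at distance \<open>a\<close> from vertex \<open>k\<close> on the edge towards vertex \<open>j\<close>. These points,
  for distinct \<open>j\<close> and \<open>k\<close>, are the vertices of the hexagon.\<close>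

definition cut_point :: "real \<Rightarrow> nat \<Rightarrow> nat \<Rightarrow> complex" where
  "cut_point a k j = tri_vertex a k + a *\<^sub>R sgn (tri_vertex a j - tri_vertex a k)"

definition corner :: "real \<Rightarrow> nat \<Rightarrow> complex set" where
  "corner a k = convex hull {tri_vertex a k, cut_point a k (k + 1), cut_point a k (k + 2)}"

definition hexagon :: "real \<Rightarrow> complex set" where
  "hexagon a = closure (tri a - (\<Union>k<3. corner a k))"

text \<open>The distance from the centre to a vertex of the hexagon, and between two endpoints of its
  standard trisection. The values do not depend on the choice of the vertex and of the
  endpoints, and the closed forms are proved below.\<close>

definition hex_radius :: "real \<Rightarrow> real" where
  "hex_radius a = dist 0 (cut_point a 0 1)"

definition hex_endpoint_dist :: "real \<Rightarrow> real" where
  "hex_endpoint_dist a =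
     dist (midpoint (tri_vertex a 0) (tri_vertex a 1)) (midpoint (tri_vertex a 1) (tri_vertex a 2))"

definition a0 :: real where
  "a0 = (THE a. 0 \<le> a \<and> a \<le> 2 powr (1/2) * 3 powr (- 3/4) \<and> hex_radius a = hex_endpoint_dist a)"

text \<open>The minor arc about the origin from \<open>x\<close> to \<open>y\<close>, for \<open>x\<close> and \<open>y\<close> on the circle of radius
  \<open>r\<close> and not antipodal.\<close>

definition minor_arc :: "real \<Rightarrow> complex \<Rightarrow> complex \<Rightarrow> complex set" where
  "minor_arc r x y = {z. dist 0 z = r \<and> (\<exists>s\<ge>0. \<exists>t\<ge>0. z = s *\<^sub>R x + t *\<^sub>R y)}"

text \<open>Replacing a short edge by an arc adds the circular segment between chord and arc, which is
  the convex hull of the arc.\<close>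

definition rounded_hexagon :: "complex set" where
  "rounded_hexagon = hexagon a0 \<union>
     (\<Union>k<3. convex hull
        minor_arc (hex_radius a0) (cut_point a0 k (k + 1)) (cut_point a0 k (k + 2)))"

definition H_tilde :: "complex set" where
  "H_tilde = (\<lambda>z. (1 / sqrt (measure lebesgue rounded_hexagon)) *\<^sub>R z) ` rounded_hexagon"

section \<open>Consistency of the definitions\<close>

lemma cis_third: "cis (2 * pi / 3) = Complex (- 1/2) (sqrt 3 / 2)"
  using cos_120 sin_120 by (simp add: complex_eq_iff)

lemma side_pos: "hex_b a + 2 * a > 0"
  unfolding hex_b_def by (simp add: add_pos_nonneg)

lemma side_sq: "(hex_b a + 2 * a)\<^sup>2 = 4 / sqrt 3 + 3 * a\<^sup>2"
  unfolding hex_b_def by simp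

lemma tri_vertex_Suc: "tri_vertex a (Suc k) = cis (2 * pi / 3) * tri_vertex a k"
proof -
  have "2 * pi * real (Suc k) / 3 = 2 * pi / 3 + 2 * pi * real k / 3"
    by (simp add: field_simps)
  then show ?thesis by (simp only: tri_vertex_def cis_mult[symmetric]) simp
qed

lemma tri_vertex_period: "tri_vertex a (k + 3) = tri_vertex a k"
proof -
  have "cis (2 * pi / 3) * (cis (2 * pi / 3) * cis (2 * pi / 3)) = 1"
    by (simp add: cis_mult)
  then show ?thesis
    by (simp add: numeral_3_eq_3 tri_vertex_Suc mult.assoc[symmetric])
qed

lemma tri_vertex_0: "tri_vertex a 0 = Complex ((hex_b a + 2 * a) / sqrt 3) 0"
  by (simp add: tri_vertex_def complex_eq_iff)

lemma tri_vertex_1: "tri_vertex a 1 = 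
    Complex (- (hex_b a + 2 * a) / (2 * sqrt 3)) ((hex_b a + 2 * a) / 2)"
proof -
  define s where "s = hex_b a + 2 * a"
  have "tri_vertex a 1 = Complex (- 1/2) (sqrt 3 / 2) * Complex (s / sqrt 3) 0"
    using tri_vertex_Suc[of a 0] by (simp only: One_nat_def tri_vertex_0 cis_third s_def)
  also have "\<dots> = Complex (- s / (2 * sqrt 3)) (s / 2)"
    by (simp add: complex_eq_iff)
  finally show ?thesis by (simp only: s_def)
qed

lemma tri_vertex_2: "tri_vertex a 2 = 
    Complex (- (hex_b a + 2 * a) / (2 * sqrt 3)) (- (hex_b a + 2 * a) / 2)"
  using tri_vertex_Suc[of a 1]
  by (simp only: Suc_1 tri_vertex_1 cis_third) (simp add: complex_eq_iff field_simps)

lemma cut_point_rot: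
  "cut_point a (Suc k) (Suc j) = cis (2 * pi / 3) * cut_point a k j"
proof -
  have "sgn (cis (2 * pi / 3) * z) = cis (2 * pi / 3) * sgn z" for z
    by (simp add: sgn_div_norm norm_mult)
  then show ?thesis
    by (simp add: cut_point_def tri_vertex_Suc distrib_left flip: right_diff_distrib)
qed

lemma cut_point_period: "cut_point a (k + 3) (j + 3) = cut_point a k j"
  by (simp only: cut_point_def tri_vertex_period)

lemma tri_edge_length:
  "dist (tri_vertex a 0) (tri_vertex a 1) = hex_b a + 2 * a"
  "dist (tri_vertex a 0) (tri_vertex a 2) = hex_b a + 2 * a"
proof -
  define s where "s = hex_b a + 2 * a"
  have s: "s > 0" unfolding s_def by (rule side_pos)
  have e: "(s / sqrt 3 + s / (2 * sqrt 3))\<^sup>2 + (s / 2)\<^sup>2 = s\<^sup>2"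
  proof -
    have "s / sqrt 3 + s / (2 * sqrt 3) = (3 / 2) * (s / sqrt 3)" by (simp add: field_simps)
    then show ?thesis by (simp add: power_mult_distrib power_divide field_simps)
  qed
  show "dist (tri_vertex a 0) (tri_vertex a 1) = hex_b a + 2 * a"
    "dist (tri_vertex a 0) (tri_vertex a 2) = hex_b a + 2 * a"
    unfolding tri_vertex_0 tri_vertex_1 tri_vertex_2 s_def[symmetric] dist_complex_def
    using e s by (simp_all add: cmod_def)
qed

lemma cut_point_0:
  "cut_point a 0 1 = Complex ((hex_b a + 2 * a) / sqrt 3 - a * sqrt 3 / 2) (a / 2)"
  "cut_point a 0 2 = Complex ((hex_b a + 2 * a) / sqrt 3 - a * sqrt 3 / 2) (- a / 2)"
proof -
  define s where "s = hex_b a + 2 * a"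
  have s: "s > 0" unfolding s_def by (rule side_pos)
  have n: "norm (tri_vertex a 1 - tri_vertex a 0) = s" "norm (tri_vertex a 2 - tri_vertex a 0) = s"
    using tri_edge_length[of a] by (simp_all add: s_def dist_norm norm_minus_commute)
  have r3: "sqrt 3 * sqrt 3 = 3" by simp
  have e: "(- s / (2 * sqrt 3) - s / sqrt 3) / s = - sqrt 3 / 2"
  proof -
    have "(- s / (2 * sqrt 3) - s / sqrt 3) / s = - 3 / (2 * sqrt 3)"
      using s by (simp add: field_simps)
    also have "\<dots> = - sqrt 3 / 2" by (simp add: field_simps)
    finally show ?thesis .
  qed
  have c1: "cut_point a 0 1 = tri_vertex a 0 + (a / s) *\<^sub>R (tri_vertex a 1 - tri_vertex a 0)"
    unfolding cut_point_def sgn_div_norm n by (simp add: divide_inverse)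
  have c2: "cut_point a 0 2 = tri_vertex a 0 + (a / s) *\<^sub>R (tri_vertex a 2 - tri_vertex a 0)"
    unfolding cut_point_def sgn_div_norm n by (simp add: divide_inverse)
  have f: "s / sqrt 3 + (a / s) * (- s / (2 * sqrt 3) - s / sqrt 3) = s / sqrt 3 - a * sqrt 3 / 2"
  proof -
    have "(a / s) * (- s / (2 * sqrt 3) - s / sqrt 3) = a * (- sqrt 3 / 2)"
      by (simp only: times_divide_eq_left times_divide_eq_right flip: e)
    then show ?thesis by simp
  qed
  show "cut_point a 0 1 = Complex ((hex_b a + 2 * a) / sqrt 3 - a * sqrt 3 / 2) (a / 2)"
    unfolding c1 tri_vertex_0 tri_vertex_1 s_def[symmetric]
    using s by (intro complex_eqI) 
      (simp_all only: plus_complex.sel minus_complex.sel scaleR_complex.sel complex.sel f, simp_all)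
  show "cut_point a 0 2 = Complex ((hex_b a + 2 * a) / sqrt 3 - a * sqrt 3 / 2) (- a / 2)"
    unfolding c2 tri_vertex_0 tri_vertex_2 s_def[symmetric]
    using s by (intro complex_eqI) 
      (simp_all only: plus_complex.sel minus_complex.sel scaleR_complex.sel complex.sel f, simp_all)
qed

lemma hex_radius_sq: "(hex_radius a)\<^sup>2 = (hex_b a + 2 * a)\<^sup>2 / 3 - a * (hex_b a + 2 * a) + a\<^sup>2"
proof -
  define s where "s = hex_b a + 2 * a"
  have "(hex_radius a)\<^sup>2 = (s / sqrt 3 - a * sqrt 3 / 2)\<^sup>2 + (a / 2)\<^sup>2"
    unfolding hex_radius_def cut_point_0(1) s_def by (simp add: cmod_power2)
  also have "\<dots> = s\<^sup>2 / 3 - a * s + a\<^sup>2"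
    by (simp add: power2_diff power_divide power_mult_distrib field_simps)
  finally show ?thesis by (simp add: s_def)
qed

lemma cut_point_norm: "dist 0 (cut_point a k (k + 1)) = hex_radius a"
  "dist 0 (cut_point a k (k + 2)) = hex_radius a"
proof (induction k)
  case 0
  { case 1 show ?case by (simp add: hex_radius_def) }
  { case 2 show ?case using cut_point_0[of a] by (simp add: hex_radius_def cmod_def numeral_2_eq_2) }
next
  case (Suc k)
  { case 1 show ?case using Suc.IH(1) by (simp add: cut_point_rot norm_mult) }
  { case 2 show ?case using Suc.IH(2) by (simp add: cut_point_rot norm_mult) }
qed

lemma hex_radius_formula:
  assumes "a \<ge> 0"
  shows "hex_radius a =
     1/3 * sqrt (4 * sqrt 3 + 18 * a\<^sup>2 - 3 * a * sqrt (12 * sqrt 3 + 27 * a\<^sup>2))"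
proof -
  have b: "hex_b a + 2 * a = sqrt (4 / sqrt 3 + 3 * a\<^sup>2)" by (simp add: hex_b_def)
  have r: "1 / sqrt 3 = sqrt 3 / 3" by (simp add: field_simps)
  have "12 * sqrt 3 + 27 * a\<^sup>2 = 3\<^sup>2 * (4 / sqrt 3 + 3 * a\<^sup>2)"
    using r by (simp add: field_simps)
  then have "sqrt (12 * sqrt 3 + 27 * a\<^sup>2) = 3 * (hex_b a + 2 * a)"
    unfolding b by (simp only: real_sqrt_mult) simp
  then have "(hex_radius a)\<^sup>2 =
      (4 * sqrt 3 + 18 * a\<^sup>2 - 3 * a * sqrt (12 * sqrt 3 + 27 * a\<^sup>2)) / 9"
    unfolding hex_radius_sq side_sq using r by (simp add: field_simps)
  then have "hex_radius a =
      sqrt ((4 * sqrt 3 + 18 * a\<^sup>2 - 3 * a * sqrt (12 * sqrt 3 + 27 * a\<^sup>2)) / 9)"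
    by (metis hex_radius_def real_sqrt_unique zero_le_dist)
  then show ?thesis by (simp add: real_sqrt_divide)
qed

lemma hex_endpoint_dist_half: "hex_endpoint_dist a = (hex_b a + 2 * a) / 2"
proof -
  have "hex_endpoint_dist a = dist (tri_vertex a 0) (tri_vertex a 2) / 2"
    by (simp add: hex_endpoint_dist_def midpoint_def dist_norm algebra_simps
        flip: scaleR_diff_right)
  then show ?thesis by (simp add: tri_edge_length)
qed

lemma hex_endpoint_dist_formula:
  "hex_endpoint_dist a = 1/2 * sqrt (3 * a\<^sup>2 + 4 / sqrt 3)"
  by (simp add: hex_endpoint_dist_half hex_b_def add.commute)

lemma range_bound_sq: "(2 powr (1/2) * 3 powr (- 3/4) :: real)\<^sup>2 = 2 / (3 * sqrt 3)"
proof -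
  have "(3 powr (- 3/4) :: real)\<^sup>2 = 3 powr (- 3/2)"
    by (simp add: powr_powr flip: powr_realpow)
  also have "\<dots> = (3 :: real) powr (-1 + - (1/2))" by simp
  also have "\<dots> = 3 powr (-1) * 3 powr (- (1/2))" by (rule powr_add)
  also have "\<dots> = 1 / (3 * sqrt 3)" by (simp add: powr_minus powr_half_sqrt field_simps)
  finally show ?thesis by (simp add: power_mult_distrib powr_half_sqrt)
qed

text \<open>Equality of the two distances is a quadratic equation for the ratio of \<open>b + 2a\<close> to \<open>a\<close>;
  in the admissible range, where the ratio is at least 3, its only root is \<open>6 + 2 * sqrt 6\<close>.\<close>

lemma hex_eq_iff:
  assumes "0 \<le> a" "a \<le> 2 powr (1/2) * 3 powr (- 3/4)"
  shows "hex_radius a = hex_endpoint_dist a \<longleftrightarrow> hex_b a + 2 * a = (6 + 2 * sqrt 6) * a"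
proof -
  define s where "s = hex_b a + 2 * a"
  have s: "s > 0" unfolding s_def by (rule side_pos)
  have s2: "s\<^sup>2 = 4 / sqrt 3 + 3 * a\<^sup>2" unfolding s_def by (rule side_sq)
  have "a\<^sup>2 \<le> 2 / (3 * sqrt 3)" using power_mono[OF assms(2,1), of 2] unfolding range_bound_sq .
  then have "(3 * a)\<^sup>2 \<le> s\<^sup>2" unfolding s2 by (simp add: field_simps)
  then have ge: "3 * a \<le> s" by (rule power2_le_imp_le) (use s in simp)
  have "hex_radius a = hex_endpoint_dist a \<longleftrightarrow> (hex_radius a)\<^sup>2 = (hex_endpoint_dist a)\<^sup>2"
    by (simp add: hex_radius_def hex_endpoint_dist_def)
  also have "\<dots> \<longleftrightarrow> s\<^sup>2 - 12 * (a * s) + 12 * a\<^sup>2 = 0"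
    unfolding hex_radius_sq hex_endpoint_dist_half s_def[symmetric]
    by (auto simp: power_divide field_simps)
  also have "\<dots> \<longleftrightarrow> (s - (6 + 2 * sqrt 6) * a) * (s - (6 - 2 * sqrt 6) * a) = 0"
    by (simp add: algebra_simps power2_eq_square)
  also have "\<dots> \<longleftrightarrow> s = (6 + 2 * sqrt 6) * a"
  proof -
    have "3 < 2 * sqrt 6" by (rule power2_less_imp_less) (auto simp: power_mult_distrib)
    have "s \<noteq> (6 - 2 * sqrt 6) * a"
    proof
      assume h: "s = (6 - 2 * sqrt 6) * a"
      then have "a > 0" using s assms by (cases "a = 0") auto
      then have "(6 - 2 * sqrt 6) * a < 3 * a" using \<open>3 < 2 * sqrt 6\<close> by simp
      then show False using h ge by simp
    qed
    then show ?thesis by auto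
  qed
  finally show ?thesis by (simp add: s_def)
qed

lemma a0_ex1:
  "\<exists>!a. 0 \<le> a \<and> a \<le> 2 powr (1/2) * 3 powr (- 3/4) \<and> hex_radius a = hex_endpoint_dist a"
proof -
  define k :: real where "k = (6 + 2 * sqrt 6)\<^sup>2 - 3"
  define B :: real where "B = 2 powr (1/2) * 3 powr (- 3/4)"
  have "(6 + 2 * sqrt 6)\<^sup>2 \<ge> (6 :: real)\<^sup>2" by (rule power_mono) auto
  then have k: "k \<ge> 33" by (simp add: k_def)
  have iff: "hex_b a + 2 * a = (6 + 2 * sqrt 6) * a \<longleftrightarrow> a\<^sup>2 * k = 4 / sqrt 3" if "a \<ge> 0" for a
  proof -
    have "hex_b a + 2 * a = (6 + 2 * sqrt 6) * a \<longleftrightarrow>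
        (hex_b a + 2 * a)\<^sup>2 = ((6 + 2 * sqrt 6) * a)\<^sup>2"
      using side_pos[of a] that by (simp add: power2_eq_iff_nonneg)
    also have "\<dots> \<longleftrightarrow> a\<^sup>2 * k = 4 / sqrt 3"
    proof -
      have "4 / sqrt 3 + 3 * a\<^sup>2 = q * a\<^sup>2 \<longleftrightarrow> a\<^sup>2 * (q - 3) = 4 / sqrt 3" for q
        by (auto simp: algebra_simps)
      then show ?thesis unfolding side_sq k_def power_mult_distrib .
    qed
    finally show ?thesis .
  qed
  define a where "a = sqrt (4 / sqrt 3 / k)"
  have a: "a \<ge> 0" "a\<^sup>2 * k = 4 / sqrt 3" using k by (simp_all add: a_def)
  have "a\<^sup>2 \<le> B\<^sup>2"
  proof -
    have "a\<^sup>2 = 4 / sqrt 3 / k" using k by (simp add: a_def)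
    also have "\<dots> \<le> 4 / sqrt 3 / 33" using k by (intro divide_left_mono) auto
    also have "\<dots> \<le> 2 / (3 * sqrt 3)" by (simp add: field_simps)
    finally show ?thesis unfolding B_def range_bound_sq .
  qed
  then have "a \<le> B" by (rule power2_le_imp_le) (simp add: B_def)
  show ?thesis
  proof (rule ex1I[of _ a])
    show "0 \<le> a \<and> a \<le> 2 powr (1/2) * 3 powr (- 3/4) \<and> hex_radius a = hex_endpoint_dist a"
      using a \<open>a \<le> B\<close> iff hex_eq_iff B_def by blast
  next
    fix a' assume h: "0 \<le> a' \<and> a' \<le> 2 powr (1/2) * 3 powr (- 3/4) \<and>
      hex_radius a' = hex_endpoint_dist a'"
    then have "a'\<^sup>2 * k = 4 / sqrt 3" using iff hex_eq_iff by blast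
    then have "a'\<^sup>2 * k = a\<^sup>2 * k" using a by simp
    then have "a'\<^sup>2 = a\<^sup>2" using k by simp
    then show "a' = a" using h a(1) by (simp add: power2_eq_iff_nonneg)
  qed
qed

lemma a0: "0 \<le> a0" "a0 \<le> 2 powr (1/2) * 3 powr (- 3/4)" "hex_radius a0 = hex_endpoint_dist a0"
  using theI'[OF a0_ex1] unfolding a0_def by auto

lemma side_a0: "hex_b a0 + 2 * a0 = (6 + 2 * sqrt 6) * a0"
  using hex_eq_iff a0 by blast

lemma a0_pos: "a0 > 0"
  using side_pos[of a0] a0(1) side_a0 by (cases "a0 = 0") auto

text \<open>The body is invariant under rotation about the origin, and it has a standard trisection.\<close>

lemma linear_cis: "linear (\<lambda>z. cis t * z)"
  by (simp add: linear_iff algebra_simps)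

lemma inj_cis: "inj (\<lambda>z. cis t * z)"
  by (simp add: inj_def)

lemma UN_shift:
  assumes "f 3 = (f 0 :: 'a set)"
  shows "(\<Union>k<3. f (Suc k)) = (\<Union>k<3. f k)"
  using assms by (auto simp: numeral_3_eq_3 lessThan_Suc)

lemma rot_tri: "(\<lambda>z. cis (2 * pi / 3) * z) ` tri a = tri a"
proof -
  have "(\<lambda>z. cis (2 * pi / 3) * z) ` (tri_vertex a ` {..<3}) = (\<Union>k<3. {tri_vertex a (Suc k)})"
    by (auto simp: tri_vertex_Suc)
  also have "\<dots> = (\<Union>k<3. {tri_vertex a k})"
    by (rule UN_shift) (use tri_vertex_period[of a 0] in simp)
  also have "\<dots> = tri_vertex a ` {..<3}" by auto
  finally show ?thesis
    unfolding tri_def by (simp only: convex_hull_linear_image[OF linear_cis])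
qed

lemma rot_corner: "(\<lambda>z. cis (2 * pi / 3) * z) ` corner a k = corner a (Suc k)"
  unfolding corner_def
  unfolding convex_hull_linear_image[OF linear_cis]
  by (simp add: tri_vertex_Suc cut_point_rot)

lemma rot_hexagon: "(\<lambda>z. cis (2 * pi / 3) * z) ` hexagon a = hexagon a"
proof -
  have "(\<lambda>z. cis (2 * pi / 3) * z) ` (\<Union>k<3. corner a k) = (\<Union>k<3. corner a k)"
  proof -
    have "corner a 3 = corner a 0"
      using tri_vertex_period[of a 0] cut_point_period[of a 0 1] cut_point_period[of a 0 2]
      by (simp add: corner_def eval_nat_numeral)
    then show ?thesis by (simp only: image_UN rot_corner UN_shift)
  qed
  then have "(\<lambda>z. cis (2 * pi / 3) * z) ` (tri a - (\<Union>k<3. corner a k)) =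
      tri a - (\<Union>k<3. corner a k)"
    by (simp only: image_set_diff[OF inj_cis] rot_tri)
  then show ?thesis
    unfolding hexagon_def
    by (simp only: closure_injective_linear_image[OF linear_cis inj_cis])
qed

lemma rot_minor_arc:
  "(\<lambda>z. cis t * z) ` minor_arc r x y = minor_arc r (cis t * x) (cis t * y)"
proof -
  have sub: "(\<lambda>z. cis t * z) ` minor_arc r x y \<subseteq> minor_arc r (cis t * x) (cis t * y)" for t x y
    by (force simp: minor_arc_def norm_mult scaleR_conv_of_real algebra_simps)
  have inv: "cis t * (cis (- t) * z) = z" "cis (- t) * (cis t * z) = z" for z
    by (simp_all add: mult.assoc[symmetric] cis_mult)
  have "minor_arc r (cis t * x) (cis t * y) =
      (\<lambda>z. cis t * z) ` (\<lambda>z. cis (- t) * z) ` minor_arc r (cis t * x) (cis t * y)"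
    by (simp add: image_image inv)
  also have "\<dots> \<subseteq> (\<lambda>z. cis t * z) ` minor_arc r x y"
    using sub[of "- t" "cis t * x" "cis t * y"] unfolding inv by (rule image_mono)
  finally show ?thesis using sub by blast
qed

lemma rot_rounded_hexagon: "(\<lambda>z. cis (2 * pi / 3) * z) ` rounded_hexagon = rounded_hexagon"
proof -
  define f where "f k = convex hull
        minor_arc (hex_radius a0) (cut_point a0 k (k + 1)) (cut_point a0 k (k + 2))" for k
  have "(\<lambda>z. cis (2 * pi / 3) * z) ` f k = f (Suc k)" for k
    unfolding f_def
    unfolding convex_hull_linear_image[OF linear_cis] rot_minor_arc
    by (simp add: cut_point_rot)
  moreover have "f 3 = f 0"
    using cut_point_period[of a0 0 1] cut_point_period[of a0 0 2]
    by (simp add: f_def eval_nat_numeral)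
  ultimately have "(\<lambda>z. cis (2 * pi / 3) * z) ` (\<Union>k<3. f k) = (\<Union>k<3. f k)"
    by (simp only: image_UN UN_shift)
  then show ?thesis
    unfolding rounded_hexagon_def f_def[symmetric] by (simp only: image_Un rot_hexagon)
qed

lemma zero_in_tri: "0 \<in> tri a"
proof -
  have t: "tri_vertex a k \<in> tri a" if "k < 3" for k
    unfolding tri_def using that by (intro hull_inc) auto
  have c: "convex (tri a)" by (simp add: tri_def)
  have "(1/2) *\<^sub>R tri_vertex a 1 + (1/2) *\<^sub>R tri_vertex a 2 \<in> tri a"
    by (rule convexD[OF c]) (auto intro: t)
  then have "(1/3) *\<^sub>R tri_vertex a 0 +
      (2/3) *\<^sub>R ((1/2) *\<^sub>R tri_vertex a 1 + (1/2) *\<^sub>R tri_vertex a 2) \<in> tri a"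
    by (intro convexD[OF c]) (auto intro: t)
  moreover have "(1/3) *\<^sub>R tri_vertex a 0 +
      (2/3) *\<^sub>R ((1/2) *\<^sub>R tri_vertex a 1 + (1/2) *\<^sub>R tri_vertex a 2) = 0"
    unfolding tri_vertex_0 tri_vertex_1 tri_vertex_2 by (simp add: complex_eq_iff field_simps)
  ultimately show ?thesis by simp
qed

lemma zero_notin_corner: "0 \<notin> corner a0 k"
proof (induction k)
  case 0
  define s where "s = hex_b a0 + 2 * a0"
  have s: "s > 0" "s \<ge> 6 * a0"
    using side_pos[of a0] a0(1) unfolding s_def by (simp, simp add: side_a0 distrib_right)
  have "s / sqrt 3 - a0 * sqrt 3 / 2 = (2 * s - 3 * a0) / (2 * sqrt 3)"
    by (simp add: field_simps)
  then have "s / sqrt 3 - a0 * sqrt 3 / 2 > 0" using s a0_pos by simp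
  then have "{tri_vertex a0 0, cut_point a0 0 1, cut_point a0 0 2} \<subseteq> {z. Re z > 0}"
    using s unfolding cut_point_0 tri_vertex_0 s_def[symmetric] by simp
  then have "corner a0 0 \<subseteq> {z. Re z > 0}"
    unfolding corner_def by (intro hull_minimal) (auto simp: convex_halfspace_Re_gt numeral_2_eq_2)
  then show ?case by auto
next
  case (Suc k)
  then show ?case by (auto simp: rot_corner[symmetric])
qed

lemma zero_in_rounded_hexagon: "0 \<in> rounded_hexagon"
proof -
  have "0 \<in> tri a0 - (\<Union>k<3. corner a0 k)"
    using zero_in_tri zero_notin_corner by auto
  then show ?thesis
    unfolding rounded_hexagon_def hexagon_def by (intro UnI1 subsetD[OF closure_subset])
qed

lemma bounded_rounded_hexagon: "bounded rounded_hexagon"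
proof -
  have "bounded (minor_arc r x y)" for r x y
    by (rule bounded_subset[OF bounded_cball[of 0 r]]) (auto simp: minor_arc_def)
  moreover have "bounded (tri a0)"
    unfolding tri_def by (simp add: bounded_convex_hull finite_imp_bounded)
  ultimately show ?thesis
    unfolding rounded_hexagon_def hexagon_def
    by (auto intro!: bounded_closure bounded_convex_hull intro: bounded_subset)
qed

lemma H_tilde_center: "rot3_center H_tilde 0"
proof -
  define c where "c = 1 / sqrt (measure lebesgue rounded_hexagon)"
  have H: "H_tilde = (\<lambda>z. c *\<^sub>R z) ` rounded_hexagon" by (simp add: H_tilde_def c_def)
  have "(\<lambda>z. cis (2 * pi / 3) * z) ` H_tilde =
      (\<lambda>z. c *\<^sub>R z) ` (\<lambda>z. cis (2 * pi / 3) * z) ` rounded_hexagon"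
    unfolding H by (simp add: image_image)
  then have "(\<lambda>z. cis (2 * pi / 3) * z) ` H_tilde = H_tilde"
    unfolding rot_rounded_hexagon H .
  then have "rotation 0 (2 * pi / 3) ` H_tilde = H_tilde"
    by (simp add: rotation_def)
  then show ?thesis
    using zero_in_rounded_hexagon by (force simp: rot3_center_def H)
qed

lemma standard_trisection_exists:
  assumes "bounded C" "rot3_center C p"
  shows "\<exists>T. standard_trisection C T"
proof -
  have "C \<noteq> {}" "C \<noteq> UNIV" using assms not_bounded_UNIV by (auto simp: rot3_center_def)
  then have "frontier C \<noteq> {}" by (simp add: frontier_eq_empty)
  then obtain m where "m \<in> frontier C" "infdist p (frontier C) = dist p m"
    using infdist_attains_inf[of "frontier C" p] frontier_closed by blast
  then show ?thesis using assms(2) unfolding standard_trisection_def by metis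
qed

lemma H_tilde_trisection_exists: "\<exists>T. standard_trisection H_tilde T"
  using bounded_scaling[OF bounded_rounded_hexagon]
  by (intro standard_trisection_exists[OF _ H_tilde_center]) (simp add: H_tilde_def)

end

theory Submission
  imports Defs
begin

text \<open>Let \<open>p\<close> be the centre of the body \<open>C\<close>, let \<open>\<rho>\<close> be the distance from \<open>p\<close> to the boundary
  and \<open>R\<close> the greatest distance from \<open>p\<close> to a point of \<open>C\<close>. The theorem follows from the formula
  \<open>d\<^sub>M = max (\<surd>3 \<rho>) R\<close> of \<open>max_rel_diameter_trisection\<close>. The lower bound is clear, because two
  neighbouring endpoints have distance \<open>\<surd>3 \<rho>\<close> and \<open>p\<close> belongs to all pieces. For the upper
  bound, a piece lies in a kite with vertices \<open>p\<close>, two endpoints \<open>v\<close> and \<open>v'\<close>, and a vertex of the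
  bounding triangle. The chord from \<open>v\<close> to \<open>v'\<close> cuts the kite into two triangles. The sides of the outer one have
  length \<open>\<surd>3 \<rho>\<close>, so only points of the inner one, which contains \<open>p\<close>, need care; they may be moved
  to \<open>v\<close>, to \<open>v'\<close>, or to \<open>p\<close>, and distances from \<open>p\<close> are at most \<open>R\<close> inside \<open>C\<close>
  (\<open>kite_diameter_le\<close>, \<open>diameter_piece_le\<close>).

  The formula reduces the problem to an area estimate. A body with \<open>d\<^sub>M = d\<close> lies in the disc of
  radius \<open>d\<close> about \<open>p\<close> and in its bounding triangle, whose inradius is at most \<open>d / \<surd>3\<close>, so it lies in
  a congruent copy of the intersection \<open>K d\<close> of the disc of radius \<open>d\<close> with a concentric equilateral
  triangle of inradius \<open>d / \<surd>3\<close> (\<open>trimmed_triangle\<close>, \<open>subset_trimmed_triangle\<close>). The area of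
  \<open>K d\<close> is proportional to \<open>d\<^sup>2\<close>. Hence unit area forces \<open>d \<ge> d'\<close>, where \<open>K d'\<close> has unit area; and
  if \<open>d = d'\<close>, then \<open>C\<close> is a closed subset of full area of a copy of \<open>K d'\<close> and therefore equal to
  it (\<open>trisection_area_bound\<close>).

  The optimal body is \<open>K d'\<close>: the parameter of the hexagon is chosen such that its
  circumradius is the distance of two endpoints, which is \<open>\<surd>3\<close> times the inradius of the
  triangle, and attaching the circular segments to the hexagon then gives exactly the part of the
  triangle inside the disc (\<open>rounded_hexagon_eq\<close>).

  A standard trisection depends on a choice of centre and of nearest boundary point. The formula
  disposes of the boundary point. The centre is determined by the metric, as the point with the
  smallest circumscribed disc (\<open>rot3_center_rigid_motion\<close>), so the value for a body does not depend
  on the trisection and is invariant under rigid motions.\<close>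

section \<open>Measure and connectedness\<close>

lemma nonexpansive_negligible_image:
  fixes f :: "'a::euclidean_space \<Rightarrow> 'a"
  assumes "\<And>x y. dist (f x) (f y) \<le> dist x y" and "negligible S"
  shows "negligible (f ` S)"
proof (rule negligible_locally_Lipschitz_image)
  show "\<exists>T B. open T \<and> x \<in> T \<and> (\<forall>y\<in>S \<inter> T. norm (f y - f x) \<le> B * norm (y - x))" for x
    using assms(1) by (intro exI[of _ UNIV] exI[of _ 1]) (simp add: dist_norm)
qed (use assms in auto)

text \<open>By Vitali's covering theorem the interior of \<open>K\<close> is, up to a null set, a disjoint union of
  balls. The map sends each of them into a ball of the same radius.\<close>

lemma nonexpansive_measure_le:
  fixes f :: "'a::euclidean_space \<Rightarrow> 'a"
  assumes f: "\<And>x y. dist (f x) (f y) \<le> dist x y" and K: "compact K" "convex K"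
  shows "measure lebesgue (f ` K) \<le> measure lebesgue K"
proof -
  define c where "c = (fst :: 'a \<times> real \<Rightarrow> 'a)"
  define r where "r = (snd :: 'a \<times> real \<Rightarrow> real)"
  define B where "B = {i. ball (c i) (r i) \<subseteq> interior K}"
  have "\<exists>i. i \<in> B \<and> x \<in> ball (c i) (r i) \<and> r i < d" if x: "x \<in> interior K" "0 < d" for x d
  proof -
    obtain e where e: "e > 0" "ball x e \<subseteq> interior K"
      using x(1) open_interior open_contains_ball by blast
    then have "ball x (min e (d / 2)) \<subseteq> interior K" by auto
    then show ?thesis
      using e x(2) unfolding B_def c_def r_def by (intro exI[of _ "(x, min e (d / 2))"]) auto
  qed
  then obtain I where I: "countable I" "I \<subseteq> B"
    "pairwise (\<lambda>i j. disjnt (ball (c i) (r i)) (ball (c j) (r j))) I"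
    "negligible (interior K - (\<Union>i\<in>I. ball (c i) (r i)))"
    by (rule Vitali_covering_theorem_balls)
  \<comment> \<open>The covering balls enumerated by the naturals, with centres moved by \<open>g\<close>; indices that
    enumerate no ball get the empty set, so that no ball is counted twice.\<close>
  define X where "X g n = (if n \<in> to_nat_on I ` I
      then ball (g (c (from_nat_into I n))) (r (from_nat_into I n)) else {})" for g :: "'a \<Rightarrow> 'a" and n
  have UN_X: "(\<Union>n. X g n) = (\<Union>i\<in>I. ball (g (c i)) (r i))" for g
    using I(1) by (force simp: X_def split: if_splits)
  have sets_X [measurable]: "X g n \<in> sets lebesgue" for g n
    by (simp add: X_def)
  have same: "emeasure lebesgue (X f n) = emeasure lebesgue (X id n)" for n
  proof (cases "r (from_nat_into I n) \<ge> 0")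
    case True
    then show ?thesis by (simp add: X_def emeasure_ball)
  next
    case False
    then have "r (from_nat_into I n) \<le> 0" by simp
    then have "ball y (r (from_nat_into I n)) = {}" for y :: "'a" by (rule ball_empty)
    then show ?thesis unfolding X_def by (simp only:)
  qed
  have disj: "disjoint_family (X id)"
    using I(1,3) by (fastforce simp: disjoint_family_on_def X_def pairwise_def disjnt_def
        to_nat_on_inj split: if_splits)
  define N where "N = frontier K \<union> (interior K - (\<Union>i\<in>I. ball (c i) (r i)))"
  have N: "negligible (f ` N)"
    unfolding N_def using I(4) negligible_convex_frontier[OF K(2)]
    by (intro nonexpansive_negligible_image f) auto
  have cov: "f ` K \<subseteq> (\<Union>n. X f n) \<union> f ` N"
  proof
    fix y assume "y \<in> f ` K"
    then obtain x where x: "x \<in> K" "y = f x" by blast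
    show "y \<in> (\<Union>n. X f n) \<union> f ` N"
    proof (cases "x \<in> N")
      case False
      then have "x \<in> (\<Union>i\<in>I. ball (c i) (r i))"
        using x(1) compact_imp_closed[OF K(1)] by (auto simp: N_def frontier_def)
      then obtain i where i: "i \<in> I" "dist (c i) x < r i" by auto
      then have "dist (f (c i)) y < r i" using f[of "c i" x] x(2) by simp
      then show ?thesis unfolding UN_X using i by auto
    qed (use x in auto)
  qed
  have "emeasure lebesgue (f ` K) \<le> emeasure lebesgue ((\<Union>n. X f n) \<union> f ` N)"
    using N by (intro emeasure_mono cov) (auto simp: negligible_imp_sets)
  also have "\<dots> = emeasure lebesgue (\<Union>n. X f n)"
    using N by (intro emeasure_Un_null_set) (auto simp: negligible_iff_null_sets)
  also have "\<dots> \<le> (\<Sum>n. emeasure lebesgue (X f n))"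
    by (intro emeasure_subadditive_countably) auto
  also have "\<dots> = (\<Sum>n. emeasure lebesgue (X id n))" by (simp only: same)
  also have "\<dots> = emeasure lebesgue (\<Union>n. X id n)"
    by (intro suminf_emeasure disj) auto
  also have "\<dots> \<le> emeasure lebesgue K"
  proof (rule emeasure_mono)
    show "(\<Union>n. X id n) \<subseteq> K"
      unfolding UN_X using I(2) interior_subset[of K] by (auto simp: B_def)
  qed (use K in \<open>simp add: lmeasurable_compact fmeasurableD\<close>)
  finally have le: "emeasure lebesgue (f ` K) \<le> emeasure lebesgue K" .
  then show ?thesis
    using K unfolding measure_def
    by (intro enn2real_mono) (auto simp: emeasure_compact_finite
        lmeasurable_compact fmeasurableD2 top.not_eq_extremum[symmetric])
qed

text \<open>A point of \<open>K\<close> outside \<open>S\<close> has a neighbourhood disjoint from \<open>S\<close>, which meets the interior of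
  the convex set \<open>K\<close> in a nonempty open set, and such a set has positive measure.\<close>

lemma convex_body_eq_if_measure_eq:
  fixes K :: "'a::euclidean_space set"
  assumes "closed S" "S \<subseteq> K" "compact K" "convex K" "interior K \<noteq> {}"
    and "measure lebesgue K \<le> measure lebesgue S"
  shows "S = K"
proof (rule ccontr)
  assume "S \<noteq> K"
  then obtain x where x: "x \<in> K" "x \<notin> S" using assms(2) by blast
  have "x \<in> closure (interior K)"
    using x(1) assms(4,5) by (simp add: convex_closure_interior closure_subset[THEN subsetD])
  moreover have "open (- S)" "x \<in> - S" using assms(1) x(2) by auto
  ultimately have ne: "- S \<inter> interior K \<noteq> {}"
    by (meson IntI closure_iff_nhds_not_empty open_Int_closure_eq_empty disjoint_iff)
  define U where "U = interior K - S"
  have U: "open U" "U \<noteq> {}" "U \<subseteq> K - S"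
    using ne assms(1) interior_subset[of K] by (auto simp: U_def)
  have K: "K \<in> lmeasurable" by (rule lmeasurable_compact[OF assms(3)])
  have S: "S \<in> lmeasurable"
    using assms by (meson closed_subset compact_Int_closed bounded_subset compact_eq_bounded_closed lmeasurable_compact)
  have "K - S \<in> lmeasurable" using K S by (rule fmeasurable_Diff[OF _ fmeasurableD])
  then have "measure lebesgue (K - S) = measure lebesgue K - measure lebesgue S"
    using K S assms(2) by (intro measurable_measure_Diff) auto
  then have "measure lebesgue (K - S) = 0"
    using assms(6) by (smt (verit) measure_nonneg)
  then have "negligible (K - S)"
    using \<open>K - S \<in> lmeasurable\<close> by (simp add: negligible_iff_measure)
  then have "negligible U" using U(3) negligible_subset by blast
  then show False using U(1,2) open_not_negligible by blast
qed

text \<open>The complement of a member is the union of the other members. Hence every member is open and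
  closed in \<open>S\<close>, and no larger subset of \<open>S\<close> that contains it is connected.\<close>

lemma components_eq_if_openin_partition:
  assumes cover: "\<Union>A = S" and disj: "pairwise disjnt A"
    and A: "\<And>X. X \<in> A \<Longrightarrow> openin (top_of_set S) X \<and> connected X \<and> X \<noteq> {}"
  shows "components S = A"
proof -
  have A_comp: "X \<in> components S" if X: "X \<in> A" for X
  proof -
    obtain x where x: "x \<in> X" using A[OF X] by blast
    have XS: "X \<subseteq> S" using X cover by blast
    define Q where "Q = connected_component_set S x"
    have xS: "x \<in> S" using x XS by blast
    have Q: "Q \<in> components S" using xS by (auto simp: components_def Q_def)
    have XQ: "X \<subseteq> Q"
      unfolding Q_def using A[OF X] x XS by (intro connected_component_maximal) auto
    have "openin (top_of_set S) (\<Union>(A - {X}))" using A by (intro openin_Union) auto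
    moreover have "S - X = \<Union>(A - {X})"
      using cover disj X by (auto simp: pairwise_def disjnt_def)
    ultimately have "closedin (top_of_set S) X"
      using XS by (simp add: closedin_def)
    then have "openin (top_of_set Q) X" "closedin (top_of_set Q) X"
      using A[OF X] XQ in_components_subset[OF Q]
      by (auto intro: openin_subset_trans closedin_subset_trans)
    then have "X = Q"
      using in_components_connected[OF Q] x unfolding connected_clopen by blast
    then show ?thesis using Q by simp
  qed
  have "Q \<in> A" if Q: "Q \<in> components S" for Q
  proof -
    obtain x where "x \<in> Q" "x \<in> S" using in_components_nonempty[OF Q] in_components_subset[OF Q] by blast
    then obtain X where "X \<in> A" "x \<in> X" using cover by blast
    then show ?thesis
      using A_comp[of X] Q \<open>x \<in> Q\<close> components_eq[OF Q, of X] by (metis IntI empty_iff)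
  qed
  then show ?thesis using A_comp by blast
qed

section \<open>The cube root of unity\<close>

definition \<omega> :: complex where "\<omega> = cis (2 * pi / 3)"

lemma omega_eq: "\<omega> = Complex (- 1/2) (sqrt 3 / 2)"
  by (simp add: \<omega>_def cis_third)

lemma omega_nonzero [simp]: "\<omega> \<noteq> 0"
  by (simp add: \<omega>_def)

lemma norm_omega [simp]: "norm \<omega> = 1"
  by (simp add: \<omega>_def)

lemma omega_cube: "\<omega> ^ 3 = 1"
  by (simp add: \<omega>_def Complex.DeMoivre)

lemma omega_square: "\<omega>\<^sup>2 = Complex (- 1/2) (- sqrt 3 / 2)"
  by (simp add: omega_eq complex_eq_iff power2_eq_square)

lemma omega_sum: "1 + \<omega> + \<omega>\<^sup>2 = 0"
  unfolding omega_square by (simp add: omega_eq complex_eq_iff)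

lemma divide_omega_power: "z / \<omega> ^ k = \<omega> ^ (2 * k) * z"
proof -
  have "\<omega> ^ k * \<omega> ^ (2 * k) = \<omega> ^ (3 * k)" by (simp flip: power_add)
  then have "\<omega> ^ k * \<omega> ^ (2 * k) = 1" by (simp add: power_mult omega_cube)
  then show ?thesis by (simp add: field_simps)
qed

lemma div_omega: "z / \<omega> = Complex (- Re z / 2 + sqrt 3 / 2 * Im z) (- Im z / 2 - sqrt 3 / 2 * Re z)"
  "z / \<omega>\<^sup>2 = Complex (- Re z / 2 - sqrt 3 / 2 * Im z) (sqrt 3 / 2 * Re z - Im z / 2)"
proof -
  have *: "z / \<omega> = z * \<omega>\<^sup>2" "z / \<omega>\<^sup>2 = z * \<omega>"
    using omega_cube by (simp_all add: field_simps power3_eq_cube power2_eq_square)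
  show "z / \<omega> = Complex (- Re z / 2 + sqrt 3 / 2 * Im z) (- Im z / 2 - sqrt 3 / 2 * Re z)"
    "z / \<omega>\<^sup>2 = Complex (- Re z / 2 - sqrt 3 / 2 * Im z) (sqrt 3 / 2 * Re z - Im z / 2)"
    unfolding * unfolding omega_square by (simp_all add: omega_eq complex_eq_iff algebra_simps)
qed

lemma cis_third_multiple: "cis (2 * pi * real k / 3) = \<omega> ^ k"
  by (simp add: \<omega>_def Complex.DeMoivre mult_ac)

lemma rotation_third_multiple: "rotation p (2 * pi * real k / 3) z = p + \<omega> ^ k * (z - p)"
  by (simp add: rotation_def cis_third_multiple)

lemma less_3_cases: "(k::nat) < 3 \<longleftrightarrow> k = 0 \<or> k = 1 \<or> k = 2"
  by auto

lemma all_less_3: "(\<forall>k<3::nat. P k) \<longleftrightarrow> P 0 \<and> P 1 \<and> P 2"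
  by (auto simp: less_3_cases)

lemma ex_less_3: "(\<exists>k<3::nat. P k) \<longleftrightarrow> P 0 \<or> P 1 \<or> P 2"
  by (auto simp: less_3_cases)

lemma Re_divide_eq_inner: "Re (z / u) = inner z u / (norm u)\<^sup>2"
  by (simp add: Re_divide inner_complex_def cmod_power2)

text \<open>Division by a power of \<open>\<omega>\<close> permutes three conditions that differ by rotations of 120 degrees.\<close>

lemma all_omega_shift:
  "(\<forall>j<3. P (z / \<omega> ^ k / \<omega> ^ j)) \<longleftrightarrow> (\<forall>j<3. P (z / \<omega> ^ j))"
proof (induction k)
  case (Suc k)
  define y where "y = z / \<omega> ^ k"
  have "\<omega> * \<omega>\<^sup>2 = 1" using omega_cube by (simp add: power3_eq_cube power2_eq_square mult.assoc)
  then have "y / \<omega> / \<omega> ^ 0 = y / \<omega> ^ 1" "y / \<omega> / \<omega> ^ 1 = y / \<omega> ^ 2" "y / \<omega> / \<omega> ^ 2 = y / \<omega> ^ 0"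
    by (simp_all add: power2_eq_square mult.assoc)
  then have "(\<forall>j<3. P (y / \<omega> / \<omega> ^ j)) \<longleftrightarrow> (\<forall>j<3. P (y / \<omega> ^ j))"
    unfolding all_less_3 by auto
  moreover have "y / \<omega> = z / \<omega> ^ Suc k" by (simp add: y_def mult.commute)
  ultimately have "(\<forall>j<3. P (z / \<omega> ^ Suc k / \<omega> ^ j)) \<longleftrightarrow> (\<forall>j<3. P (z / \<omega> ^ k / \<omega> ^ j))"
    by (simp only: y_def)
  then show ?case using Suc by simp
qed simp

section \<open>The bounding triangle\<close>

text \<open>Faces of a simplex are the hulls of sets of vertices, and those of dimension one come from two
  vertices.\<close>

lemma edge_of_triangle:
  fixes a b c :: complex
  assumes nc: "\<not> collinear {a, b, c}"
  shows "closed_segment x y edge_of convex hull {a, b, c} \<longleftrightarrow>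
    {x, y} = {a, b} \<or> {x, y} = {b, c} \<or> {x, y} = {a, c}"
proof -
  have dist: "a \<noteq> b" "b \<noteq> c" "a \<noteq> c"
    using nc by (auto simp: insert_commute)
  have ind: "\<not> affine_dependent {a, b, c}"
    using nc affine_dependent_imp_collinear_3 by blast
  have face: "F face_of convex hull {a, b, c} \<longleftrightarrow> (\<exists>S\<subseteq>{a, b, c}. F = convex hull S)" for F
    by (rule face_of_convex_hull_affine_independent[OF ind])
  have two: "S = {a, b} \<or> S = {b, c} \<or> S = {a, c}" if "S \<subseteq> {a, b, c}" "card S = 2" for S
    using that by (auto simp: card_2_iff)
  show ?thesis
  proof
    assume "closed_segment x y edge_of convex hull {a, b, c}"
    then obtain S where S: "S \<subseteq> {a, b, c}" "closed_segment x y = convex hull S"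
        "aff_dim (convex hull S) = 1"
      unfolding edge_of_def face by auto
    have "\<not> affine_dependent S" using affine_independent_subset[OF ind S(1)] .
    then have "card S = 2" using S(3) aff_dim_affine_independent[of S] by (simp add: aff_dim_convex_hull)
    then have "S = {a, b} \<or> S = {b, c} \<or> S = {a, c}" using two S(1) by blast
    then show "{x, y} = {a, b} \<or> {x, y} = {b, c} \<or> {x, y} = {a, c}"
      using S(2) by (elim disjE) (simp_all only: segment_convex_hull[symmetric] closed_segment_eq simp_thms)
  next
    assume xy: "{x, y} = {a, b} \<or> {x, y} = {b, c} \<or> {x, y} = {a, c}"
    have "{x, y} \<subseteq> {a, b, c}" using xy by blast
    moreover have "x \<noteq> y" using xy dist by (auto simp: doubleton_eq_iff)
    ultimately show "closed_segment x y edge_of convex hull {a, b, c}"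
      unfolding edge_of_def face segment_convex_hull
      by (intro conjI exI[of _ "{x, y}"]) (simp_all add: aff_dim_convex_hull aff_dim_2)
  qed
qed

text \<open>In the coordinate \<open>\<zeta> = (z - p) / (m - p)\<close> the centre is \<open>0\<close>, the nearest boundary point is \<open>1\<close>
  and the bounding lines are the tangents of the unit circle at the powers of \<open>\<omega>\<close>.\<close>

lemma bounding_line_iff:
  assumes "m \<noteq> p"
  shows "z \<in> bounding_line p m k \<longleftrightarrow> Re ((z - p) / ((m - p) * \<omega> ^ k)) = 1"
proof -
  have e: "m - p \<noteq> 0" using assms by simp
  have *: "inner (w - m) (m - p) = 0 \<longleftrightarrow> Re ((w - p) / (m - p)) = 1" for w
  proof -
    have "w - m = (m - p) * ((w - p) / (m - p) - 1)" using e by (simp add: field_simps)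
    then have "inner (w - m) (m - p) = inner ((m - p) * ((w - p) / (m - p) - 1)) ((m - p) * 1)"
      by simp
    also have "\<dots> = (norm (m - p))\<^sup>2 * (Re ((w - p) / (m - p)) - 1)"
      unfolding inner_complex_def cmod_power2 times_complex.sel minus_complex.sel one_complex.sel
      by (simp only: power2_eq_square) algebra
    finally show ?thesis using e by simp
  qed
  have "z \<in> bounding_line p m k \<longleftrightarrow> (\<exists>w. Re ((w - p) / (m - p)) = 1 \<and> z = p + \<omega> ^ k * (w - p))"
    unfolding bounding_line_def rotation_third_multiple * by blast
  also have "\<dots> \<longleftrightarrow> Re ((z - p) / ((m - p) * \<omega> ^ k)) = 1"
  proof
    assume "Re ((z - p) / ((m - p) * \<omega> ^ k)) = 1"
    then show "\<exists>w. Re ((w - p) / (m - p)) = 1 \<and> z = p + \<omega> ^ k * (w - p)"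
      by (intro exI[of _ "p + (z - p) / \<omega> ^ k"]) (simp add: field_simps)
  next
    assume "\<exists>w. Re ((w - p) / (m - p)) = 1 \<and> z = p + \<omega> ^ k * (w - p)"
    then obtain w where w: "Re ((w - p) / (m - p)) = 1" "z = p + \<omega> ^ k * (w - p)" by blast
    have "(z - p) / ((m - p) * \<omega> ^ k) = (w - p) / (m - p)" unfolding w(2) by simp
    then show "Re ((z - p) / ((m - p) * \<omega> ^ k)) = 1" using w(1) by simp
  qed
  finally show ?thesis .
qed

lemma bounding_triangle_eq:
  assumes "m \<noteq> p"
  shows "bounding_triangle p m = convex hull
    {p - 2 * (m - p), p - 2 * (m - p) * \<omega>, p - 2 * (m - p) * \<omega>\<^sup>2}" (is "_ = convex hull ?V")
proof -
  have e: "m - p \<noteq> 0" using assms by simp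
  have "{z. \<exists>j<3. \<exists>k<3. j \<noteq> k \<and> z \<in> bounding_line p m j \<inter> bounding_line p m k} = ?V"
  proof (intro set_eqI)
    fix z
    define \<zeta> where "\<zeta> = (z - p) / (m - p)"
    have z: "z = p + (m - p) * \<zeta>" using e by (simp add: \<zeta>_def)
    define x y where "x = Re \<zeta>" and "y = Im \<zeta>"
    have line: "z \<in> bounding_line p m k \<longleftrightarrow> Re (\<zeta> / \<omega> ^ k) = 1" for k
      unfolding bounding_line_iff[OF assms] \<zeta>_def by (simp add: field_simps)
    have l: "z \<in> bounding_line p m 0 \<longleftrightarrow> x = 1"
      "z \<in> bounding_line p m 1 \<longleftrightarrow> - x / 2 + sqrt 3 / 2 * y = 1"
      "z \<in> bounding_line p m 2 \<longleftrightarrow> - x / 2 - sqrt 3 / 2 * y = 1"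
      unfolding line by (simp_all add: div_omega x_def y_def)
    have V: "z = p - 2 * (m - p) * c \<longleftrightarrow> x = - 2 * Re c \<and> y = - 2 * Im c" for c
    proof -
      have "z = p - 2 * (m - p) * c \<longleftrightarrow> (m - p) * \<zeta> = (m - p) * (- 2 * c)"
        unfolding z by (simp add: algebra_simps eq_neg_iff_add_eq_0)
      also have "\<dots> \<longleftrightarrow> \<zeta> = - 2 * c" using e by (metis mult_left_cancel)
      finally show ?thesis by (simp add: complex_eq_iff x_def y_def)
    qed
    have V3: "z \<in> ?V \<longleftrightarrow> (x = - 2 \<and> y = 0) \<or> (x = 1 \<and> y = - sqrt 3) \<or> (x = 1 \<and> y = sqrt 3)"
      using V[of 1] V[of \<omega>] V[of "\<omega>\<^sup>2"] by (simp add: omega_square) (simp add: omega_eq)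
    have s: "1 / 2 = sqrt 3 / 2 * (sqrt 3 / 3)" "sqrt 3 * sqrt 3 = 3" by simp_all
    \<comment> \<open>Two of the three tangents meet at a vertex of the triangle, which is \<open>- 2\<close> times a power of \<open>\<omega>\<close>.\<close>
    have i01: "x = 1 \<and> - x / 2 + sqrt 3 / 2 * y = 1 \<longleftrightarrow> x = 1 \<and> y = sqrt 3"
    proof -
      have "sqrt 3 / 2 * y = 3 / 2 \<longleftrightarrow> sqrt 3 / 2 * y = sqrt 3 / 2 * sqrt 3" by simp
      also have "\<dots> \<longleftrightarrow> y = sqrt 3" by (subst mult_cancel_left) simp
      finally show ?thesis by auto
    qed
    have i02: "x = 1 \<and> - x / 2 - sqrt 3 / 2 * y = 1 \<longleftrightarrow> x = 1 \<and> y = - sqrt 3"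
    proof -
      have "- (sqrt 3 / 2 * y) = 3 / 2 \<longleftrightarrow> sqrt 3 / 2 * y = sqrt 3 / 2 * (- sqrt 3)" by auto
      also have "\<dots> \<longleftrightarrow> y = - sqrt 3" by (subst mult_cancel_left) simp
      finally show ?thesis by auto
    qed
    have i12: "- x / 2 + sqrt 3 / 2 * y = 1 \<and> - x / 2 - sqrt 3 / 2 * y = 1 \<longleftrightarrow> x = - 2 \<and> y = 0"
    proof -
      have "- x / 2 + sqrt 3 / 2 * y = 1 \<and> - x / 2 - sqrt 3 / 2 * y = 1 \<longleftrightarrow>
          x = - 2 \<and> sqrt 3 / 2 * y = 0" by linarith
      then show ?thesis by simp
    qed
    have "(\<exists>j<3. \<exists>k<3. j \<noteq> k \<and> z \<in> bounding_line p m j \<inter> bounding_line p m k) \<longleftrightarrow>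
        (z \<in> bounding_line p m 0 \<and> z \<in> bounding_line p m 1) \<or>
        (z \<in> bounding_line p m 0 \<and> z \<in> bounding_line p m 2) \<or>
        (z \<in> bounding_line p m 1 \<and> z \<in> bounding_line p m 2)"
      unfolding ex_less_3 by auto
    then show "z \<in> {z. \<exists>j<3. \<exists>k<3. j \<noteq> k \<and> z \<in> bounding_line p m j \<inter> bounding_line p m k} \<longleftrightarrow>
        z \<in> ?V"
      unfolding mem_Collect_eq V3 l i01 i02 i12 by blast
  qed
  then show ?thesis by (simp only: bounding_triangle_def)
qed

text \<open>The imaginary part is the cross product of two edge vectors.\<close>

lemma not_collinear_if_cross_nonzero:
  fixes a b c :: complex
  assumes "Im (cnj (b - a) * (c - a)) \<noteq> 0"
  shows "\<not> collinear {a, b, c}"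
proof
  assume "collinear {a, b, c}"
  then obtain u where u: "\<And>x y. x \<in> {a, b, c} \<Longrightarrow> y \<in> {a, b, c} \<Longrightarrow> \<exists>t. x - y = t *\<^sub>R u"
    unfolding collinear_def by blast
  obtain s t where "b - a = s *\<^sub>R u" "c - a = t *\<^sub>R u" using u by blast
  then show False using assms by (simp add: scaleR_complex.sel algebra_simps)
qed

lemma trisection_endpoints_eq:
  assumes "m \<noteq> p"
  shows "trisection_endpoints p m = {p + (m - p), p + (m - p) * \<omega>, p + (m - p) * \<omega>\<^sup>2}"
proof -
  define e where "e = m - p"
  have e: "e \<noteq> 0" using assms by (simp add: e_def)
  define a b c where "a = p - 2 * e" and "b = p - 2 * e * \<omega>" and "c = p - 2 * e * \<omega>\<^sup>2"
  have "Im (cnj (b - a) * (c - a)) = 4 * (norm e)\<^sup>2 * Im (cnj (1 - \<omega>) * (1 - \<omega>\<^sup>2))"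
  proof -
    have "cnj (b - a) * (c - a) = 4 * (e * cnj e) * (cnj (1 - \<omega>) * (1 - \<omega>\<^sup>2))"
      by (simp add: a_def b_def c_def algebra_simps)
    then show ?thesis unfolding complex_norm_square[symmetric] by simp
  qed
  moreover have "Im (cnj (1 - \<omega>) * (1 - \<omega>\<^sup>2)) = 3 / 2 * sqrt 3"
    unfolding omega_square by (simp add: omega_eq)
  ultimately have "Im (cnj (b - a) * (c - a)) = 4 * (norm e)\<^sup>2 * (3 / 2 * sqrt 3)" by (simp only:)
  then have "Im (cnj (b - a) * (c - a)) \<noteq> 0" using e by (simp only:) simp
  then have nc: "\<not> collinear {a, b, c}" by (rule not_collinear_if_cross_nonzero)
  have mid: "midpoint a b = p + e * \<omega>\<^sup>2" "midpoint b c = p + e" "midpoint a c = p + e * \<omega>"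
  proof -
    have "1 + \<omega> + \<omega>\<^sup>2 = 0" unfolding omega_square by (simp add: omega_eq complex_eq_iff)
    then have *: "\<omega>\<^sup>2 = - 1 - \<omega>" by (simp add: algebra_simps eq_neg_iff_add_eq_0)
    show "midpoint a b = p + e * \<omega>\<^sup>2" "midpoint b c = p + e" "midpoint a c = p + e * \<omega>"
      unfolding midpoint_def a_def b_def c_def * by (simp_all add: scaleR_conv_of_real field_simps)
  qed
  have "trisection_endpoints p m = {midpoint a b, midpoint b c, midpoint a c}"
    unfolding trisection_endpoints_def bounding_triangle_eq[OF assms] e_def[symmetric]
      a_def[symmetric] b_def[symmetric] c_def[symmetric] edge_of_triangle[OF nc]
    by (auto simp: doubleton_eq_iff midpoint_sym)
  then show ?thesis unfolding mid e_def by auto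
qed

section \<open>The pieces of the trisection\<close>

lemma linear_mult_left: "linear (\<lambda>z :: complex. u * z)"
  by (simp add: linear_iff algebra_simps)

text \<open>The open sector of 120 degrees at \<open>0\<close> between the directions \<open>1\<close> and \<open>\<omega>\<close>. For
  \<open>\<zeta> = s + t \<omega>\<close> the two conditions say \<open>t > 0\<close> and \<open>s > 0\<close>.\<close>

definition wedge :: "complex set" where
  "wedge = {\<zeta>. 0 < Im \<zeta> \<and> 0 < sqrt 3 * Re \<zeta> + Im \<zeta>}"

text \<open>The open sector at \<open>p\<close> between the directions \<open>u\<close> and \<open>\<omega> u\<close>.\<close>

definition sector :: "complex \<Rightarrow> complex \<Rightarrow> complex set" where
  "sector p u = {z. (z - p) / u \<in> wedge}"

lemma convex_wedge: "convex wedge" and open_wedge: "open wedge"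
proof -
  have *: "wedge = {\<zeta>. Im \<zeta> > 0} \<inter> {\<zeta>. inner (Complex (sqrt 3) 1) \<zeta> > 0}"
    by (auto simp: wedge_def inner_complex_def)
  show "convex wedge"
    unfolding * by (intro convex_Int convex_halfspace_Im_gt convex_halfspace_gt)
  show "open wedge"
    unfolding * by (intro open_Int open_halfspace_Im_gt open_halfspace_gt)
qed

lemma sector_eq_image: "u \<noteq> 0 \<Longrightarrow> sector p u = (\<lambda>z. p + z) ` (\<lambda>z. u * z) ` wedge"
  by (force simp: sector_def image_iff)

lemma convex_sector: "u \<noteq> 0 \<Longrightarrow> convex (sector p u)"
  by (simp add: sector_eq_image convex_translation convex_linear_image[OF linear_mult_left convex_wedge])

lemma open_sector: "u \<noteq> 0 \<Longrightarrow> open (sector p u)"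
  unfolding sector_def
  by (rule open_vimage[OF open_wedge, unfolded vimage_def]) (auto intro!: continuous_intros)

lemma wedge_omega_iff:
  "\<zeta> / \<omega> \<in> wedge \<longleftrightarrow> sqrt 3 * Re \<zeta> + Im \<zeta> < 0 \<and> sqrt 3 * Re \<zeta> < Im \<zeta>"
  "\<zeta> / \<omega>\<^sup>2 \<in> wedge \<longleftrightarrow> Im \<zeta> < sqrt 3 * Re \<zeta> \<and> Im \<zeta> < 0"
proof -
  have r: "sqrt 3 * (sqrt 3 * t) = 3 * t" for t :: real by (simp flip: mult.assoc)
  show "\<zeta> / \<omega> \<in> wedge \<longleftrightarrow> sqrt 3 * Re \<zeta> + Im \<zeta> < 0 \<and> sqrt 3 * Re \<zeta> < Im \<zeta>"
    "\<zeta> / \<omega>\<^sup>2 \<in> wedge \<longleftrightarrow> Im \<zeta> < sqrt 3 * Re \<zeta> \<and> Im \<zeta> < 0"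
    unfolding wedge_def div_omega by (auto simp: algebra_simps r)
qed

text \<open>The three sectors leave only the rays through the powers of \<open>\<omega>\<close>.\<close>

lemma ray_cases:
  fixes \<zeta> :: complex
  assumes "\<zeta> \<notin> wedge" "\<zeta> / \<omega> \<notin> wedge" "\<zeta> / \<omega>\<^sup>2 \<notin> wedge"
  shows "\<exists>t\<ge>0. \<zeta> = of_real t \<or> \<zeta> = of_real t * \<omega> \<or> \<zeta> = of_real t * \<omega>\<^sup>2"
proof -
  define q where "q = sqrt 3 * Re \<zeta>"
  have h: "\<not> (0 < Im \<zeta> \<and> 0 < q + Im \<zeta>)" "\<not> (q + Im \<zeta> < 0 \<and> q < Im \<zeta>)" "\<not> (Im \<zeta> < q \<and> Im \<zeta> < 0)"
    using assms unfolding wedge_omega_iff unfolding wedge_def q_def by auto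
  then consider "Im \<zeta> = 0" "q \<ge> 0" | "q = - Im \<zeta>" "Im \<zeta> \<ge> 0" | "q = Im \<zeta>" "Im \<zeta> \<le> 0"
    by linarith
  then show ?thesis
  proof cases
    case 1
    then show ?thesis by (intro exI[of _ "Re \<zeta>"]) (simp add: q_def complex_eq_iff zero_le_mult_iff)
  next
    case 2
    then have "Re \<zeta> = - Im \<zeta> / sqrt 3" by (simp add: q_def field_simps)
    then show ?thesis using 2
      by (intro exI[of _ "2 * Im \<zeta> / sqrt 3"]) (simp add: omega_eq complex_eq_iff)
  next
    case 3
    then have "Re \<zeta> = Im \<zeta> / sqrt 3" by (simp add: q_def field_simps)
    then show ?thesis using 3
      by (intro exI[of _ "- 2 * Im \<zeta> / sqrt 3"]) (simp add: omega_square complex_eq_iff divide_le_0_iff)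
  qed
qed

lemma ray_notin_wedge:
  assumes "t \<ge> 0" "\<zeta> = of_real t \<or> \<zeta> = of_real t * \<omega> \<or> \<zeta> = of_real t * \<omega>\<^sup>2"
  shows "\<zeta> \<notin> wedge" "\<zeta> / \<omega> \<notin> wedge" "\<zeta> / \<omega>\<^sup>2 \<notin> wedge"
  using assms unfolding wedge_omega_iff unfolding wedge_def omega_square
  by (auto simp: omega_eq mult_le_0_iff zero_le_mult_iff mult_less_0_iff)

lemma wedge_disjoint:
  assumes "j < 3" "k < 3" "j \<noteq> k"
  shows "\<not> (\<zeta> / \<omega> ^ j \<in> wedge \<and> \<zeta> / \<omega> ^ k \<in> wedge)"
proof -
  have "\<zeta> \<in> wedge \<longleftrightarrow> 0 < Im \<zeta> \<and> 0 < sqrt 3 * Re \<zeta> + Im \<zeta>" by (simp add: wedge_def)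
  then show ?thesis
    using assms wedge_omega_iff[of \<zeta>] unfolding less_3_cases by auto
qed

text \<open>The hypotheses on real parts place \<open>C\<close> on the inner side of the bounding lines, so that the ray from
  \<open>p\<close> through an endpoint leaves \<open>C\<close> there. Cutting along the three segments is therefore the same as
  cutting along the three rays, and what remains is the union of three disjoint sectors of \<open>C\<close>,
  each convex and relatively open.\<close>

lemma trisection_eq:
  assumes "convex C" "u \<noteq> 0" "p \<in> C"
    and inC: "p + u \<in> C" "p + u * \<omega> \<in> C" "p + u * \<omega>\<^sup>2 \<in> C"
    and le: "\<And>z k. z \<in> C \<Longrightarrow> k < 3 \<Longrightarrow> Re ((z - p) / (u * \<omega> ^ k)) \<le> 1"
  shows "trisection C p (p + u) = (\<lambda>k. closure (C \<inter> sector p (u * \<omega> ^ k))) ` {..<3}"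
proof -
  define S where "S = (\<Union>v\<in>trisection_endpoints p (p + u). closed_segment p v)"
  have in_sector: "z \<in> sector p (u * \<omega> ^ k) \<longleftrightarrow> ((z - p) / u) / \<omega> ^ k \<in> wedge" for z k
    by (simp add: sector_def)
  have S: "z \<in> S \<longleftrightarrow> (\<exists>t. 0 \<le> t \<and> t \<le> 1 \<and>
      (z = p + u * of_real t \<or> z = p + u * (of_real t * \<omega>) \<or> z = p + u * (of_real t * \<omega>\<^sup>2)))" for z
  proof -
    have "z \<in> closed_segment p (p + v) \<longleftrightarrow> (\<exists>t. 0 \<le> t \<and> t \<le> 1 \<and> z = p + v * of_real t)" for v
      by (auto simp: closed_segment_def scaleR_conv_of_real algebra_simps)
    moreover have "S = closed_segment p (p + u) \<union> closed_segment p (p + u * \<omega>) \<union>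
        closed_segment p (p + u * \<omega>\<^sup>2)"
      unfolding S_def using assms(2) by (subst trisection_endpoints_eq) auto
    ultimately show ?thesis by (auto simp: mult_ac)
  qed
  have "C - S = (\<Union>k<3. C \<inter> sector p (u * \<omega> ^ k))"
  proof (intro set_eqI iffI)
    fix z assume z: "z \<in> C - S"
    show "z \<in> (\<Union>k<3. C \<inter> sector p (u * \<omega> ^ k))"
    proof (rule ccontr)
      assume "z \<notin> (\<Union>k<3. C \<inter> sector p (u * \<omega> ^ k))"
      then have n: "(z - p) / u / \<omega> ^ k \<notin> wedge" if "k < 3" for k
        using z that in_sector by blast
      obtain t where t: "t \<ge> 0" "(z - p) / u = of_real t \<or> (z - p) / u = of_real t * \<omega> \<or>
          (z - p) / u = of_real t * \<omega>\<^sup>2"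
        using ray_cases[of "(z - p) / u"] n[of 0] n[of 1] n[of 2] by auto
      have "\<exists>k<3. (z - p) / (u * \<omega> ^ k) = of_real t"
        using t(2)
      proof (elim disjE)
        assume "(z - p) / u = of_real t"
        then show ?thesis by (intro exI[of _ 0]) simp
      next
        assume "(z - p) / u = of_real t * \<omega>"
        then have "(z - p) / (u * \<omega> ^ 1) = of_real t" using assms(2) by (simp add: field_simps)
        then show ?thesis by (intro exI[of _ 1]) simp
      next
        assume "(z - p) / u = of_real t * \<omega>\<^sup>2"
        then have "(z - p) / (u * \<omega> ^ 2) = of_real t" using assms(2) by (simp add: field_simps)
        then show ?thesis by (intro exI[of _ 2]) simp
      qed
      then have "t \<le> 1" using le[of z] z by fastforce
      moreover have "z = p + u * ((z - p) / u)" using assms(2) by simp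
      ultimately have "z \<in> S" unfolding S using t by metis
      then show False using z by simp
    qed
  next
    fix z assume "z \<in> (\<Union>k<3. C \<inter> sector p (u * \<omega> ^ k))"
    then obtain k where k: "k < 3" "z \<in> C" "(z - p) / u / \<omega> ^ k \<in> wedge"
      using in_sector by auto
    have "z \<notin> S"
    proof
      assume "z \<in> S"
      then obtain t where t: "t \<ge> 0" "(z - p) / u = of_real t \<or> (z - p) / u = of_real t * \<omega> \<or>
          (z - p) / u = of_real t * \<omega>\<^sup>2"
        unfolding S using assms(2) by auto
      show False using ray_notin_wedge[OF t] k less_3_cases[of k] by auto
    qed
    then show "z \<in> C - S" using k by simp
  qed
  have disj: "sector p (u * \<omega> ^ j) \<inter> sector p (u * \<omega> ^ k) = {}" if "j < 3" "k < 3" "j \<noteq> k" for j k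
    using wedge_disjoint[OF that] unfolding disjoint_iff in_sector by blast
  have "components (C - S) = (\<lambda>k. C \<inter> sector p (u * \<omega> ^ k)) ` {..<3}"
  proof (rule components_eq_if_openin_partition)
    show "pairwise disjnt ((\<lambda>k. C \<inter> sector p (u * \<omega> ^ k)) ` {..<3})"
      using disj by (fastforce simp: pairwise_def disjnt_def)
    fix X assume "X \<in> (\<lambda>k. C \<inter> sector p (u * \<omega> ^ k)) ` {..<3}"
    then obtain k where k: "k < 3" "X = C \<inter> sector p (u * \<omega> ^ k)" by auto
    have u: "u * \<omega> ^ k \<noteq> 0" using assms(2) by simp
    have "X = (C - S) \<inter> sector p (u * \<omega> ^ k)"
      using k \<open>C - S = _\<close> by auto
    then have "openin (top_of_set (C - S)) X"
      using open_sector[OF u] by (simp add: openin_open_Int)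
    moreover have "connected X"
      unfolding k(2) by (intro convex_connected convex_Int assms(1) convex_sector u)
    moreover have "X \<noteq> {}"
    proof -
      \<comment> \<open>The midpoint of two neighbouring endpoints lies inside the sector.\<close>
      have "p + u * \<omega> ^ k * ((1 + \<omega>) / 2) \<in> C"
      proof -
        have c: "\<omega> * (\<omega> * \<omega>) = 1" using omega_cube by (simp add: power3_eq_cube mult.assoc)
        have "p + u * \<omega> ^ k \<in> C" "p + u * \<omega> ^ Suc k \<in> C"
          using k(1) inC c by (auto simp: less_3_cases power2_eq_square)
        then have "(1/2) *\<^sub>R (p + u * \<omega> ^ k) + (1/2) *\<^sub>R (p + u * \<omega> ^ Suc k) \<in> C"
          by (intro convexD[OF assms(1)]) auto
        moreover have "(1/2) *\<^sub>R (p + u * \<omega> ^ k) + (1/2) *\<^sub>R (p + u * \<omega> ^ Suc k) =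
            p + u * \<omega> ^ k * ((1 + \<omega>) / 2)"
          by (simp add: scaleR_conv_of_real field_simps)
        ultimately show ?thesis by simp
      qed
      moreover have "p + u * \<omega> ^ k * ((1 + \<omega>) / 2) \<in> sector p (u * \<omega> ^ k)"
      proof -
        have "(p + u * \<omega> ^ k * ((1 + \<omega>) / 2) - p) / (u * \<omega> ^ k) = (1 + \<omega>) / 2"
          using u by simp
        moreover have "(1 + \<omega>) / 2 \<in> wedge"
          by (simp add: wedge_def omega_eq)
        ultimately show ?thesis by (simp only: sector_def mem_Collect_eq)
      qed
      ultimately show ?thesis unfolding k(2) by blast
    qed
    ultimately show "openin (top_of_set (C - S)) X \<and> connected X \<and> X \<noteq> {}" by blast
  qed (use \<open>C - S = _\<close> in auto)
  then show ?thesis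
    unfolding trisection_def S_def by (simp add: image_image)
qed

text \<open>Two points in the same triangle are no farther apart than two of its vertices. If they are in
  different triangles, the one in \<open>abc\<close> may be moved to a vertex: for \<open>a\<close> the bound is a
  hypothesis, and \<open>b\<close> and \<open>c\<close> also belong to the other triangle. A bound on the
  distance from \<open>a\<close> to \<open>d\<close>, which may exceed \<open>D\<close>, is replaced by bounds on the distances from
  \<open>a\<close> to the two points.\<close>

lemma kite_diameter_le:
  fixes a b c x y :: complex
  assumes "x \<in> convex hull {a, b, c} \<union> convex hull {b, c, d}"
    and "y \<in> convex hull {a, b, c} \<union> convex hull {b, c, d}"
    and ab: "norm (a - b) \<le> D" "norm (a - c) \<le> D" "norm (b - c) \<le> D"
      "norm (b - d) \<le> D" "norm (c - d) \<le> D"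
    and "norm (x - a) \<le> D" "norm (y - a) \<le> D"
  shows "norm (x - y) \<le> D"
proof -
  have D: "D \<ge> 0" using ab(1) norm_ge_zero[of "a - b"] by linarith
  have lower: "norm (x - y) \<le> D" if "x \<in> convex hull {a, b, c}" "y \<in> convex hull {a, b, c}" for x y
    using simplex_extremal_le_exists[OF _ that] ab D by (fastforce simp: norm_minus_commute)
  have upper: "norm (x - y) \<le> D" if "x \<in> convex hull {b, c, d}" "y \<in> convex hull {b, c, d}" for x y
    using simplex_extremal_le_exists[OF _ that] ab D by (fastforce simp: norm_minus_commute)
  have mixed: "norm (x - y) \<le> D"
    if x: "x \<in> convex hull {a, b, c}" and y: "y \<in> convex hull {b, c, d}" "norm (y - a) \<le> D" for x y
  proof -
    obtain v where v: "v \<in> {a, b, c}" "norm (x - y) \<le> norm (v - y)"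
      using simplex_furthest_le_exists[of "{a, b, c}" y] x by auto
    have "norm (b - y) \<le> D" "norm (c - y) \<le> D"
      using y(1) by (auto intro!: upper hull_inc)
    then show ?thesis using v y(2) by (auto simp: norm_minus_commute)
  qed
  show ?thesis
    using assms(1,2,8,9) lower upper mixed[of x y] mixed[of y x] by (auto simp: norm_minus_commute)
qed

text \<open>With \<open>\<zeta> = s + t \<omega>\<close> the chord from \<open>1\<close> to \<open>\<omega>\<close> is \<open>s + t = 1\<close>, and \<open>2 * (1 + \<omega>)\<close> is the intersection
  of the tangents at \<open>1\<close> and \<open>\<omega>\<close>.\<close>

lemma kite_subset_triangles:
  assumes "0 \<le> Im \<zeta>" "0 \<le> sqrt 3 * Re \<zeta> + Im \<zeta>" "Re \<zeta> \<le> 1" "Re (\<zeta> / \<omega>) \<le> 1"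
  shows "\<zeta> \<in> convex hull {0, 1, \<omega>} \<union> convex hull {1, \<omega>, 2 * (1 + \<omega>)}"
proof -
  define t where "t = 2 * Im \<zeta> / sqrt 3"
  define s where "s = Re \<zeta> + t / 2"
  have "Im \<zeta> = sqrt 3 * t / 2" "Re \<zeta> = s - t / 2" by (simp_all add: t_def s_def)
  then have \<zeta>: "\<zeta> = of_real s + of_real t * \<omega>" by (simp add: omega_eq complex_eq_iff)
  have t: "t \<ge> 0" using assms(1) by (simp add: t_def)
  have "sqrt 3 * s = sqrt 3 * Re \<zeta> + Im \<zeta>"
    unfolding s_def t_def by (simp add: field_simps)
  then have s: "s \<ge> 0" using assms(2) by (metis zero_le_mult_iff real_sqrt_gt_0_iff zero_less_numeral linorder_not_le)
  have le1: "s - t / 2 \<le> 1" using assms(3) by (simp add: s_def)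
  have *: "sqrt 3 / 2 * Im \<zeta> = 3 / 4 * t" unfolding t_def by (simp add: field_simps)
  have "- Re \<zeta> / 2 + sqrt 3 / 2 * Im \<zeta> \<le> 1"
    using assms(4) by (simp add: div_omega)
  then have le2: "t - s / 2 \<le> 1" unfolding * s_def by (simp add: field_simps)
  show ?thesis
  proof (cases "s + t \<le> 1")
    case True
    have "\<zeta> \<in> convex hull {0, 1, \<omega>}"
      unfolding convex_hull_3 using True s t
      by (intro CollectI exI[of _ "1 - s - t"] exI[of _ s] exI[of _ t]) (simp add: \<zeta> scaleR_conv_of_real)
    then show ?thesis by blast
  next
    case False
    have "\<zeta> \<in> convex hull {1, \<omega>, 2 * (1 + \<omega>)}"
      unfolding convex_hull_3 using False s t le1 le2
      by (intro CollectI exI[of _ "(s - 2 * t + 2) / 3"] exI[of _ "(t - 2 * s + 2) / 3"]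
          exI[of _ "(s + t - 1) / 3"]) (simp add: \<zeta> scaleR_conv_of_real field_simps)
    then show ?thesis by blast
  qed
qed

lemma kite_vertex_dist:
  "norm (1 - \<omega>) = sqrt 3" "norm (1 - 2 * (1 + \<omega>)) = sqrt 3" "norm (\<omega> - 2 * (1 + \<omega>)) = sqrt 3"
proof -
  have "1 - \<omega> = Complex (3/2) (- sqrt 3 / 2)" "1 - 2 * (1 + \<omega>) = Complex 0 (- sqrt 3)"
    "\<omega> - 2 * (1 + \<omega>) = Complex (- 3/2) (- sqrt 3 / 2)"
    by (simp_all add: omega_eq complex_eq_iff)
  then show "norm (1 - \<omega>) = sqrt 3" "norm (1 - 2 * (1 + \<omega>)) = sqrt 3" "norm (\<omega> - 2 * (1 + \<omega>)) = sqrt 3"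
    by (simp_all add: complex_norm power_divide)
qed

text \<open>The midpoint \<open>g\<close> of two neighbouring endpoints is in the open sector, and so is the whole
  segment from \<open>g\<close> to a point \<open>z\<close> of the closed sector, except possibly \<open>z\<close> itself.\<close>

lemma closure_piece_supset:
  assumes "convex C" "u \<noteq> 0" "p \<in> C" "p + u \<in> C" "p + u * \<omega> \<in> C"
    and z: "z \<in> C" "0 \<le> Im ((z - p) / u)" "0 \<le> sqrt 3 * Re ((z - p) / u) + Im ((z - p) / u)"
  shows "z \<in> closure (C \<inter> sector p u)"
proof -
  define g where "g = p + u * ((1 + \<omega>) / 2)"
  have "g = (1/2) *\<^sub>R (p + u) + (1/2) *\<^sub>R (p + u * \<omega>)"
    by (simp add: g_def scaleR_conv_of_real field_simps)
  then have g: "g \<in> C"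
    using convexD[OF assms(1,4,5), of "1/2" "1/2"] by simp
  have gw: "(g - p) / u = (1 + \<omega>) / 2" using assms(2) by (simp add: g_def)
  have combine: "0 < (1 - t) * y + t * (sqrt 3 / 4) \<and>
      0 < sqrt 3 * ((1 - t) * x + t * (1 / 4)) + ((1 - t) * y + t * (sqrt 3 / 4))"
    if "0 \<le> (1 - t) * y" "0 \<le> (1 - t) * (sqrt 3 * x + y)" "0 < t * (sqrt 3 / 4)" for t x y :: real
  proof -
    have "sqrt 3 * ((1 - t) * x + t * (1 / 4)) + ((1 - t) * y + t * (sqrt 3 / 4)) =
        (1 - t) * (sqrt 3 * x + y) + 2 * (t * (sqrt 3 / 4))"
      by (simp add: algebra_simps)
    then show ?thesis using that by linarith
  qed
  have in_piece: "(1 - t) *\<^sub>R z + t *\<^sub>R g \<in> C \<inter> sector p u" if t: "0 < t" "t \<le> 1" for t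
  proof
    show "(1 - t) *\<^sub>R z + t *\<^sub>R g \<in> C"
      by (intro convexD[OF assms(1)]) (use t g z in auto)
    have "((1 - t) *\<^sub>R z + t *\<^sub>R g - p) / u = (1 - t) *\<^sub>R ((z - p) / u) + t *\<^sub>R ((g - p) / u)"
      using assms(2) by (simp add: scaleR_conv_of_real field_simps)
    also have "\<dots> \<in> wedge"
    proof -
      have "0 \<le> (1 - t) * Im ((z - p) / u)" using t z by simp
      moreover have "0 \<le> (1 - t) * (sqrt 3 * Re ((z - p) / u) + Im ((z - p) / u))" using t z by simp
      moreover have "t * (sqrt 3 / 4) > 0" using t by simp
      moreover have "(1 + \<omega>) / 2 = Complex (1 / 4) (sqrt 3 / 4)"
        by (simp add: omega_eq complex_eq_iff)
      ultimately show ?thesis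
        unfolding gw wedge_def mem_Collect_eq plus_complex.sel scaleR_complex.sel
        using combine[of t "Im ((z - p) / u)" "Re ((z - p) / u)"]
        by (simp only: complex.sel)
    qed
    finally show "(1 - t) *\<^sub>R z + t *\<^sub>R g \<in> sector p u" by (simp add: sector_def)
  qed
  have "((\<lambda>t. (1 - t) *\<^sub>R z + t *\<^sub>R g) \<longlongrightarrow> (1 - 0) *\<^sub>R z + 0 *\<^sub>R g) (at_right 0)"
    by (intro tendsto_intros)
  moreover have "\<forall>\<^sub>F t in at_right 0. (1 - t) *\<^sub>R z + t *\<^sub>R g \<in> closure (C \<inter> sector p u)"
    using eventually_at_right_real[of 0 1, OF zero_less_one]
    by (rule eventually_mono) (use in_piece closure_subset in force)
  ultimately have "(1 - 0) *\<^sub>R z + 0 *\<^sub>R g \<in> closure (C \<inter> sector p u)"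
    by (intro Lim_in_closed_set) auto
  then show ?thesis by simp
qed

text \<open>In the coordinate \<open>(z - p) / u\<close> the piece is contained in the kite with vertices \<open>0\<close>, \<open>1\<close>,
  \<open>2 * (1 + \<omega>)\<close> and \<open>\<omega>\<close>, and \<open>1\<close>, \<open>\<omega>\<close> and \<open>2 * (1 + \<omega>)\<close> form an equilateral triangle of
  side \<open>\<surd>3\<close>.\<close>

lemma diameter_piece_le:
  assumes "u \<noteq> 0" "p \<in> C"
    and le: "\<And>z. z \<in> C \<Longrightarrow> Re ((z - p) / u) \<le> 1" "\<And>z. z \<in> C \<Longrightarrow> Re ((z - p) / (u * \<omega>)) \<le> 1"
    and D: "sqrt 3 * norm u \<le> D" "\<And>z. z \<in> C \<Longrightarrow> dist p z \<le> D" "bounded C"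
  shows "diameter (closure (C \<inter> sector p u)) \<le> D"
proof -
  define E where "E = D / norm u"
  have nu: "norm u > 0" using assms(1) by simp
  have E: "sqrt 3 \<le> E" using D(1) nu by (simp add: E_def field_simps)
  have "1 \<le> E" using E real_sqrt_ge_one[of 3] by linarith
  then have vd: "norm (0 - 1 :: complex) \<le> E" "norm (0 - \<omega>) \<le> E"
    "norm (1 - \<omega>) \<le> E" "norm (1 - 2 * (1 + \<omega>)) \<le> E" "norm (\<omega> - 2 * (1 + \<omega>)) \<le> E"
    using E unfolding kite_vertex_dist by auto
  have mem: "(z - p) / u \<in> convex hull {0, 1, \<omega>} \<union> convex hull {1, \<omega>, 2 * (1 + \<omega>)}"
    "norm ((z - p) / u - 0) \<le> E" if "z \<in> C \<inter> sector p u" for z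
  proof -
    have "(z - p) / (u * \<omega>) = (z - p) / u / \<omega>" by simp
    then show "(z - p) / u \<in> convex hull {0, 1, \<omega>} \<union> convex hull {1, \<omega>, 2 * (1 + \<omega>)}"
      using that le[of z] by (intro kite_subset_triangles) (auto simp: sector_def wedge_def)
    show "norm ((z - p) / u - 0) \<le> E"
      using D(2)[of z] that nu by (simp add: E_def norm_divide dist_norm norm_minus_commute divide_right_mono)
  qed
  have "dist x y \<le> D" if "x \<in> C \<inter> sector p u" "y \<in> C \<inter> sector p u" for x y
  proof -
    have "norm ((x - p) / u - (y - p) / u) \<le> E"
      by (rule kite_diameter_le[OF mem(1)[OF that(1)] mem(1)[OF that(2)] vd mem(2)[OF that(1)] mem(2)[OF that(2)]])
    moreover have "(x - p) / u - (y - p) / u = (x - y) / u" by (simp add: diff_divide_distrib)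
    ultimately show ?thesis
      using nu by (simp add: E_def norm_divide dist_norm divide_le_cancel)
  qed
  moreover have "D \<ge> 0" using D(2)[OF assms(2)] by simp
  ultimately have "diameter (C \<inter> sector p u) \<le> D"
    by (intro diameter_le) (auto simp: dist_norm)
  moreover have "bounded (C \<inter> sector p u)" using D(3) bounded_subset by blast
  ultimately show ?thesis by (simp add: diameter_closure)
qed

section \<open>Bodies of threefold symmetry\<close>

lemma rot3_center_mem:
  assumes "rot3_center C p" "z \<in> C"
  shows "p + \<omega> ^ k * (z - p) \<in> C"
proof (induction k)
  case (Suc k)
  have "rotation p (2 * pi / 3) (p + \<omega> ^ k * (z - p)) \<in> C"
    using Suc assms(1) unfolding rot3_center_def by blast
  then show ?case by (simp add: rotation_def \<omega>_def mult.assoc)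
qed (use assms in simp)

lemma rot3_center_mem_divide:
  assumes "rot3_center C p" "z \<in> C"
  shows "p + (z - p) / \<omega> ^ k \<in> C"
  using rot3_center_mem[OF assms, of "2 * k"] by (simp add: divide_omega_power)

text \<open>The centre is the mean of the three rotated copies of any point. Applied to all points of a ball
  inside \<open>C\<close>, this gives a ball of the same radius about the centre.\<close>

lemma rot3_center_interior:
  assumes "convex C" "interior C \<noteq> {}" "rot3_center C p"
  shows "p \<in> interior C"
proof -
  obtain x where "x \<in> interior C" using assms(2) by blast
  then obtain e where e: "e > 0" "ball x e \<subseteq> C" using mem_interior by blast
  have "y \<in> C" if y: "y \<in> ball p e" for y
  proof -
    define d where "d = y - p"
    have rot: "p + \<omega> ^ k * (x - p) + d \<in> C" for k
    proof -
      have "norm (d / \<omega> ^ k) < e" using y by (simp add: d_def norm_divide norm_power dist_norm norm_minus_commute)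
      then have "x + d / \<omega> ^ k \<in> C" using e(2) by (auto simp: dist_norm)
      then have "p + \<omega> ^ k * (x + d / \<omega> ^ k - p) \<in> C" by (rule rot3_center_mem[OF assms(3)])
      then show ?thesis by (simp add: algebra_simps)
    qed
    have "p + \<omega> ^ 1 * (x - p) + d \<in> C" by (rule rot)
    moreover have "(1/3) *\<^sub>R (p + \<omega> ^ 0 * (x - p) + d) +
        (2/3) *\<^sub>R ((1/2) *\<^sub>R (p + \<omega> ^ 1 * (x - p) + d) + (1/2) *\<^sub>R (p + \<omega> ^ 2 * (x - p) + d)) \<in> C"
      by (intro convexD[OF assms(1)] rot) auto
    moreover have "(1/3) *\<^sub>R (p + \<omega> ^ 0 * (x - p) + d) +
        (2/3) *\<^sub>R ((1/2) *\<^sub>R (p + \<omega> ^ 1 * (x - p) + d) + (1/2) *\<^sub>R (p + \<omega> ^ 2 * (x - p) + d)) =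
        p + d + (1 + \<omega> + \<omega>\<^sup>2) * (x - p) / 3"
      by (simp add: scaleR_conv_of_real field_simps)
    ultimately show ?thesis by (simp add: omega_sum d_def)
  qed
  then show ?thesis using e(1) mem_interior by blast
qed

lemma cball_infdist_frontier_subset:
  fixes C :: "'a::euclidean_space set"
  assumes "compact C" "p \<in> interior C"
  shows "0 < infdist p (frontier C)" "cball p (infdist p (frontier C)) \<subseteq> C"
proof -
  define \<rho> where "\<rho> = infdist p (frontier C)"
  have pC: "p \<in> C" using assms(2) interior_subset by blast
  have "C \<noteq> {}" "C \<noteq> UNIV"
    using assms(1) pC compact_imp_bounded not_bounded_UNIV by blast+
  then have ne: "frontier C \<noteq> {}" by (simp add: frontier_eq_empty)
  have "p \<notin> frontier C" using assms(2) by (simp add: frontier_def)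
  then show pos: "0 < infdist p (frontier C)"
    using in_closed_iff_infdist_zero[OF frontier_closed ne, of p] infdist_nonneg[of p "frontier C"] by auto
  have "ball p \<rho> \<inter> frontier C = {}"
    using infdist_le[of _ "frontier C" p] by (fastforce simp: \<rho>_def)
  moreover have "p \<in> ball p \<rho> \<inter> C" using pC pos by (simp add: \<rho>_def)
  ultimately have "ball p \<rho> - C = {}"
    using connected_Int_frontier[OF connected_ball, of p \<rho> C] by blast
  then have "closure (ball p \<rho>) \<subseteq> C"
    using compact_imp_closed[OF assms(1)] by (intro closure_minimal) auto
  then show "cball p (infdist p (frontier C)) \<subseteq> C" using pos by (simp add: \<rho>_def)
qed

text \<open>A supporting line of \<open>C\<close> at \<open>m\<close> also supports the largest disc about \<open>p\<close> inside \<open>C\<close>, which has \<open>m\<close> on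
  its boundary. So it is the tangent of this disc at \<open>m\<close>; formally, the Cauchy-Schwarz
  inequality for the normal \<open>a\<close> and the radius \<open>m - p\<close> is an equality.\<close>

lemma nearest_point_supports:
  assumes C: "compact C" "convex C" "p \<in> interior C"
    and m: "m \<in> frontier C" "dist p m = infdist p (frontier C)" and z: "z \<in> C"
  shows "Re ((z - p) / (m - p)) \<le> 1"
proof -
  define \<rho> where "\<rho> = norm (m - p)"
  have \<rho>: "\<rho> = infdist p (frontier C)" using m(2) by (simp add: \<rho>_def dist_norm norm_minus_commute)
  have pos: "\<rho> > 0" and ball: "cball p \<rho> \<subseteq> C"
    using cball_infdist_frontier_subset[OF C(1,3)] by (simp_all add: \<rho>)
  have "m \<in> closure C" "m \<notin> rel_interior C"
    using m(1) C(3) rel_interior_nonempty_interior[of C] by (auto simp: frontier_def)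
  then obtain a where a: "a \<noteq> 0" "\<And>y. y \<in> closure C \<Longrightarrow> inner a m \<le> inner a y"
    using supporting_hyperplane_relative_frontier[OF C(2)] by metis
  have "p - (\<rho> / norm a) *\<^sub>R a \<in> C"
    using ball a(1) pos by (auto simp: dist_norm)
  then have "inner a m \<le> inner a (p - (\<rho> / norm a) *\<^sub>R a)" using a(2) closure_subset by blast
  also have "\<dots> = inner a p - \<rho> * norm a"
    using a(1) by (simp add: inner_diff_right dot_square_norm power2_eq_square)
  finally have "\<rho> * norm a \<le> inner (- a) (m - p)" by (simp add: inner_diff_right)
  moreover have "inner (- a) (m - p) \<le> norm (- a) * norm (m - p)" by (rule norm_cauchy_schwarz)
  ultimately have "inner (- a) (m - p) = norm (- a) * norm (m - p)" by (simp add: \<rho>_def mult.commute)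
  then have par: "norm a *\<^sub>R (m - p) = - (\<rho> *\<^sub>R a)" unfolding norm_cauchy_schwarz_eq by (simp add: \<rho>_def)
  have "inner a (m - p) \<le> inner a (z - p)"
    using a(2)[of z] z closure_subset by (auto simp: inner_diff_right)
  then have "\<rho> * inner a (z - p) \<ge> \<rho> * inner a (m - p)" using pos by simp
  then have "inner (- (\<rho> *\<^sub>R a)) (z - p) \<le> inner (- (\<rho> *\<^sub>R a)) (m - p)" by simp
  then have "inner (m - p) (z - p) \<le> inner (m - p) (m - p)"
    unfolding par[symmetric] using a(1) by simp
  then show ?thesis
    using pos unfolding Re_divide_eq_inner \<rho>_def by (simp add: inner_commute power2_norm_eq_inner)
qed

lemma nearest_point_supports_rotated:
  assumes "planar_convex_body C" "rot3_center C p"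
    and "m \<in> frontier C" "dist p m = infdist p (frontier C)" "z \<in> C"
  shows "Re ((z - p) / ((m - p) * \<omega> ^ k)) \<le> 1"
proof -
  have C: "compact C" "convex C" "p \<in> interior C"
    using assms(1,2) rot3_center_interior by (auto simp: planar_convex_body_def)
  have "Re ((p + (z - p) / \<omega> ^ k - p) / (m - p)) \<le> 1"
    by (rule nearest_point_supports[OF C assms(3,4) rot3_center_mem_divide[OF assms(2,5)]])
  then show ?thesis by (simp add: mult.commute)
qed

section \<open>The maximum relative diameter\<close>

definition outer_radius :: "complex set \<Rightarrow> complex \<Rightarrow> real" where
  "outer_radius C p = (SUP z\<in>C. dist p z)"

lemma dist_le_outer_radius: "bounded C \<Longrightarrow> z \<in> C \<Longrightarrow> dist p z \<le> outer_radius C p"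
  unfolding outer_radius_def
  by (rule cSUP_upper) (auto simp: bounded_any_center[of C p] bdd_above_def)

lemma outer_radius_attained:
  assumes "compact C" "C \<noteq> {}"
  obtains z where "z \<in> C" "outer_radius C p = dist p z"
proof -
  obtain z where z: "z \<in> C" "\<And>y. y \<in> C \<Longrightarrow> dist p y \<le> dist p z"
    using continuous_attains_sup[of C "dist p"] assms by (force intro: continuous_intros)
  then have "outer_radius C p = dist p z"
    unfolding outer_radius_def by (intro cSup_eq_maximum) auto
  then show ?thesis using z that by blast
qed

lemma outer_radius_le: "C \<noteq> {} \<Longrightarrow> (\<And>z. z \<in> C \<Longrightarrow> dist p z \<le> r) \<Longrightarrow> outer_radius C p \<le> r"
  unfolding outer_radius_def by (rule cSUP_least)

text \<open>The three closed sectors cover the plane.\<close>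

lemma closed_wedge_cases:
  "\<exists>k<3. 0 \<le> Im (\<zeta> / \<omega> ^ k) \<and> 0 \<le> sqrt 3 * Re (\<zeta> / \<omega> ^ k) + Im (\<zeta> / \<omega> ^ k)"
proof -
  have r: "sqrt 3 * (sqrt 3 * t) = 3 * t" for t :: real by (simp flip: mult.assoc)
  have 1: "0 \<le> Im (\<zeta> / \<omega>) \<and> 0 \<le> sqrt 3 * Re (\<zeta> / \<omega>) + Im (\<zeta> / \<omega>) \<longleftrightarrow>
      sqrt 3 * Re \<zeta> + Im \<zeta> \<le> 0 \<and> sqrt 3 * Re \<zeta> \<le> Im \<zeta>"
    unfolding div_omega by (auto simp: algebra_simps r)
  have 2: "0 \<le> Im (\<zeta> / \<omega>\<^sup>2) \<and> 0 \<le> sqrt 3 * Re (\<zeta> / \<omega>\<^sup>2) + Im (\<zeta> / \<omega>\<^sup>2) \<longleftrightarrow>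
      Im \<zeta> \<le> sqrt 3 * Re \<zeta> \<and> Im \<zeta> \<le> 0"
    unfolding div_omega by (auto simp: algebra_simps r)
  show ?thesis
    unfolding ex_less_3 power_one_right power_0 div_by_1 1 2 by linarith
qed

text \<open>Both terms are attained in some piece: the first by two neighbouring endpoints, the second by \<open>p\<close>
  and a farthest point, since \<open>p\<close> belongs to the closure of every piece.\<close>

theorem max_rel_diameter_trisection:
  assumes C: "planar_convex_body C" "rot3_center C p"
    and m: "m \<in> frontier C" "dist p m = infdist p (frontier C)"
  shows "max_rel_diameter (trisection C p m) =
    max (sqrt 3 * infdist p (frontier C)) (outer_radius C p)"
proof -
  define u where "u = m - p"
  have cpt: "compact C" "convex C" "p \<in> interior C" "p \<in> C"
    using C rot3_center_interior by (auto simp: planar_convex_body_def rot3_center_def)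
  have nu: "norm u = infdist p (frontier C)"
    using m(2) by (simp add: u_def dist_norm norm_minus_commute)
  have u: "u \<noteq> 0" using cball_infdist_frontier_subset(1)[OF cpt(1,3)] nu by auto
  have le: "Re ((z - p) / (u * \<omega> ^ k)) \<le> 1" if "z \<in> C" for z k
    unfolding u_def using nearest_point_supports_rotated[OF C m that] .
  have "m \<in> C" using m(1) compact_imp_closed[OF cpt(1)] by (auto simp: frontier_def)
  then have v: "p + u * \<omega> ^ k \<in> C" for k
    using rot3_center_mem[OF C(2), of m k] by (simp add: u_def mult.commute)
  define P where "P k = closure (C \<inter> sector p (u * \<omega> ^ k))" for k :: nat
  have T: "trisection C p m = P ` {..<3}"
    using trisection_eq[OF cpt(2) u cpt(4) _ _ _ le] v[of 0] v[of 1] v[of 2] by (simp add: u_def P_def)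
  have uk: "u * \<omega> ^ k \<noteq> 0" for k using u by simp
  have sup: "z \<in> P k" if "z \<in> C" "0 \<le> Im ((z - p) / (u * \<omega> ^ k))"
    "0 \<le> sqrt 3 * Re ((z - p) / (u * \<omega> ^ k)) + Im ((z - p) / (u * \<omega> ^ k))" for z k
    unfolding P_def using v[of k] v[of "Suc k"] that
    by (intro closure_piece_supset cpt uk) (simp_all add: mult_ac)
  have bd: "bounded (P k)" for k
    unfolding P_def using compact_imp_bounded[OF cpt(1)] by (intro bounded_closure) (auto intro: bounded_subset)
  have D: "max_rel_diameter (trisection C p m) = Max ((\<lambda>k. diameter (P k)) ` {..<3})"
    unfolding max_rel_diameter_def T image_image ..
  have nonempty: "{..<3::nat} \<noteq> {}" by (rule ex_in_conv[THEN iffD1]) (rule exI[of _ 0], simp)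
  have ge: "diameter (P k) \<le> Max ((\<lambda>k. diameter (P k)) ` {..<3})" if "k < 3" for k
    using that by (intro Max_ge) auto
  show ?thesis
    unfolding D
  proof (rule antisym)
    show "Max ((\<lambda>k. diameter (P k)) ` {..<3}) \<le> max (sqrt 3 * infdist p (frontier C)) (outer_radius C p)"
    proof (rule Max.boundedI)
      fix d assume "d \<in> (\<lambda>k. diameter (P k)) ` {..<3}"
      then obtain k where k: "d = diameter (P k)" by auto
      have "Re ((z - p) / (u * \<omega> ^ k * \<omega>)) \<le> 1" if "z \<in> C" for z
        using le[OF that, of "Suc k"] by (simp add: mult_ac)
      then have "diameter (P k) \<le> max (sqrt 3 * infdist p (frontier C)) (outer_radius C p)"
        unfolding P_def using compact_imp_bounded[OF cpt(1)] nu
        by (intro diameter_piece_le[OF uk cpt(4) le])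
          (auto simp: norm_mult norm_power le_max_iff_disj dist_le_outer_radius)
      then show "d \<le> max (sqrt 3 * infdist p (frontier C)) (outer_radius C p)" by (simp add: k)
    qed (use nonempty in simp_all)
    have "sqrt 3 * infdist p (frontier C) \<le> diameter (P 0)"
    proof -
      have "p + u \<in> P 0" using v[of 0] u by (intro sup) auto
      moreover have "p + u * \<omega> \<in> P 0" using v[of 1] u by (intro sup) (auto simp: omega_eq)
      ultimately have "dist (p + u) (p + u * \<omega>) \<le> diameter (P 0)"
        by (intro diameter_bounded_bound bd)
      moreover have "p + u - (p + u * \<omega>) = u * (1 - \<omega>)" by (simp add: algebra_simps)
      ultimately show ?thesis by (simp add: dist_norm norm_mult kite_vertex_dist nu mult.commute)
    qed
    moreover have "outer_radius C p \<le> Max ((\<lambda>k. diameter (P k)) ` {..<3})"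
    proof -
      obtain z where z: "z \<in> C" "outer_radius C p = dist p z"
        using outer_radius_attained[OF cpt(1)] cpt(4) by blast
      obtain k where k: "k < 3" "0 \<le> Im ((z - p) / u / \<omega> ^ k)"
          "0 \<le> sqrt 3 * Re ((z - p) / u / \<omega> ^ k) + Im ((z - p) / u / \<omega> ^ k)"
        using closed_wedge_cases[of "(z - p) / u"] by blast
      have "z \<in> P k" using k z by (intro sup) simp_all
      moreover have "p \<in> P k" by (intro sup cpt) simp_all
      ultimately have "dist p z \<le> diameter (P k)" by (intro diameter_bounded_bound bd)
      then show ?thesis using ge[OF k(1)] z(2) by linarith
    qed
    ultimately show "max (sqrt 3 * infdist p (frontier C)) (outer_radius C p) \<le>
        Max ((\<lambda>k. diameter (P k)) ` {..<3})"
      using order_trans[OF _ ge[of 0]] by simp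
  qed
qed

section \<open>The extremal shape\<close>

text \<open>The part inside the disc of radius \<open>d\<close> about \<open>0\<close> of the equilateral triangle with centre \<open>0\<close>,
  inradius \<open>d / sqrt 3\<close> and vertices in the directions of the powers of \<open>\<omega>\<close>. A body of this shape
  with \<open>p = 0\<close> makes the two terms \<open>sqrt 3 * \<rho>\<close> and \<open>R\<close> of the formula above both at most \<open>d\<close>.\<close>

definition trimmed_triangle :: "real \<Rightarrow> complex set" where
  "trimmed_triangle d = {z. norm z \<le> d \<and> (\<forall>k<3. - d / sqrt 3 \<le> Re (z / \<omega> ^ k))}"

lemma subset_trimmed_triangle:
  assumes C: "planar_convex_body C" "rot3_center C p"
    and d: "sqrt 3 * infdist p (frontier C) \<le> d" "outer_radius C p \<le> d"
  shows "\<exists>u. norm u = 1 \<and> C \<subseteq> (\<lambda>z. p + u * z) ` trimmed_triangle d"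
proof -
  have cpt: "compact C" "p \<in> interior C" "p \<in> C"
    using C rot3_center_interior by (auto simp: planar_convex_body_def rot3_center_def)
  have "C \<noteq> UNIV" using compact_imp_bounded[OF cpt(1)] not_bounded_UNIV by blast
  then have "frontier C \<noteq> {}" using cpt(3) by (auto simp: frontier_eq_empty)
  then obtain m where m: "m \<in> frontier C" "dist p m = infdist p (frontier C)"
    using infdist_attains_inf[of "frontier C" p] frontier_closed by metis
  define \<rho> where "\<rho> = norm (m - p)"
  have \<rho>: "\<rho> = infdist p (frontier C)" using m(2) by (simp add: \<rho>_def dist_norm norm_minus_commute)
  have pos: "\<rho> > 0" using cball_infdist_frontier_subset(1)[OF cpt(1,2)] \<rho> by simp
  \<comment> \<open>The endpoint \<open>m\<close> corresponds to a point opposite to a vertex of the triangle, whence the sign.\<close>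
  define u where "u = - (m - p) / of_real \<rho>"
  have nu: "norm u = 1" using pos by (simp add: u_def norm_divide \<rho>_def norm_minus_commute)
  have u0: "u \<noteq> 0" using nu by auto
  have "z \<in> (\<lambda>z. p + u * z) ` trimmed_triangle d" if z: "z \<in> C" for z
  proof -
    have "norm ((z - p) / u) \<le> d"
      using dist_le_outer_radius[OF compact_imp_bounded[OF cpt(1)] z, of p] d(2) nu
      by (simp add: norm_divide dist_norm norm_minus_commute)
    moreover have "- d / sqrt 3 \<le> Re ((z - p) / u / \<omega> ^ k)" for k
    proof -
      have quotient: "a / u / c = - of_real \<rho> * (a / ((m - p) * c))" for a c by (simp add: u_def del: minus_diff_eq)
      have "(z - p) / u / \<omega> ^ k = - of_real \<rho> * ((z - p) / ((m - p) * \<omega> ^ k))"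
        by (rule quotient)
      moreover have "Re (- of_real \<rho> * w) = - (\<rho> * Re w)" for w by simp
      ultimately have "Re ((z - p) / u / \<omega> ^ k) = - (\<rho> * Re ((z - p) / ((m - p) * \<omega> ^ k)))"
        by (simp only:)
      moreover have "\<rho> * Re ((z - p) / ((m - p) * \<omega> ^ k)) \<le> \<rho> * 1"
        using nearest_point_supports_rotated[OF C m z] pos by (intro mult_left_mono) auto
      moreover have "\<rho> \<le> d / sqrt 3" using d(1) by (simp add: \<rho> field_simps)
      ultimately show ?thesis by simp
    qed
    ultimately have "(z - p) / u \<in> trimmed_triangle d" by (simp add: trimmed_triangle_def)
    moreover have "z = p + u * ((z - p) / u)" using u0 by simp
    ultimately show ?thesis by blast
  qed
  then show ?thesis using nu by blast
qed

lemma trimmed_triangle_rotate: "z / \<omega> ^ k \<in> trimmed_triangle d \<longleftrightarrow> z \<in> trimmed_triangle d"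
  unfolding trimmed_triangle_def mem_Collect_eq
  by (subst all_omega_shift) (simp add: norm_divide norm_power)

text \<open>The barycentric coordinates of \<open>z\<close> with respect to the vertices \<open>w * \<omega> ^ k\<close> are
  \<open>1 / 3 + 2 * Re (z / \<omega> ^ k) / (3 * w)\<close>.\<close>

lemma convex_hull_omega_orbit:
  assumes w: "w > 0"
  shows "convex hull {of_real w, of_real w * \<omega>, of_real w * \<omega>\<^sup>2} = {z. \<forall>k<3. - w / 2 \<le> Re (z / \<omega> ^ k)}"
proof
  have "convex {z. - w / 2 \<le> Re (z / \<omega> ^ k)}" for k
  proof -
    have "{z. - w / 2 \<le> Re (z / \<omega> ^ k)} = {z. inner (\<omega> ^ k) z \<ge> - w / 2}"
      by (simp add: Re_divide_eq_inner norm_power inner_commute)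
    then show ?thesis by (simp add: convex_halfspace_ge)
  qed
  moreover have "{z. \<forall>k<3. - w / 2 \<le> Re (z / \<omega> ^ k)} = (\<Inter>k<3. {z. - w / 2 \<le> Re (z / \<omega> ^ k)})"
    by auto
  ultimately have "convex {z. \<forall>k<3. - w / 2 \<le> Re (z / \<omega> ^ k)}"
    by (simp add: convex_INT)
  moreover have "{of_real w, of_real w * \<omega>, of_real w * \<omega>\<^sup>2} \<subseteq> {z. \<forall>k<3. - w / 2 \<le> Re (z / \<omega> ^ k)}"
  proof -
    have r: "sqrt 3 * (t * sqrt 3) = 3 * t" for t :: real by simp
    have cx: "Re \<omega> = - 1/2" "Im \<omega> = sqrt 3 / 2" "Re (\<omega>\<^sup>2) = - 1/2" "Im (\<omega>\<^sup>2) = - sqrt 3 / 2"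
      unfolding omega_square by (simp_all add: omega_eq)
    show ?thesis unfolding all_less_3 power_0 power_one_right div_omega using w
      by (simp add: cx r)
  qed
  ultimately show "convex hull {of_real w, of_real w * \<omega>, of_real w * \<omega>\<^sup>2} \<subseteq>
      {z. \<forall>k<3. - w / 2 \<le> Re (z / \<omega> ^ k)}"
    by (simp add: hull_minimal)
next
  show "{z. \<forall>k<3. - w / 2 \<le> Re (z / \<omega> ^ k)} \<subseteq> convex hull {of_real w, of_real w * \<omega>, of_real w * \<omega>\<^sup>2}"
  proof
    fix z assume "z \<in> {z. \<forall>k<3. - w / 2 \<le> Re (z / \<omega> ^ k)}"
    then have z: "- w / 2 \<le> Re z" "- w / 2 \<le> - Re z / 2 + sqrt 3 / 2 * Im z"
        "- w / 2 \<le> - Re z / 2 - sqrt 3 / 2 * Im z"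
      unfolding mem_Collect_eq all_less_3 by (simp_all add: div_omega)
    define b where "b t = 1/3 + 2 * t / (3 * w)" for t
    have b: "b t \<ge> 0" if "- w / 2 \<le> t" for t using that w by (simp add: b_def field_simps)
    define x y where "x = Re z" and "y = sqrt 3 * Im z"
    have sum: "b x + b (- x / 2 + y / 2) + b (- x / 2 - y / 2) = 1"
      using w by (simp add: b_def field_simps)
    have re: "w * b x - w * b (- x / 2 + y / 2) / 2 - w * b (- x / 2 - y / 2) / 2 = x"
      using w by (simp add: b_def field_simps)
    have "w * b (- x / 2 + y / 2) - w * b (- x / 2 - y / 2) = 2 * y / 3"
      using w by (simp add: b_def field_simps)
    then have "sqrt 3 / 2 * (w * b (- x / 2 + y / 2) - w * b (- x / 2 - y / 2)) = sqrt 3 / 2 * (2 * y / 3)"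
      by (simp only:)
    also have "\<dots> = Im z" by (simp add: y_def)
    finally have im: "sqrt 3 / 2 * (w * b (- x / 2 + y / 2) - w * b (- x / 2 - y / 2)) = Im z" .
    have "Re z = w * b x - w * b (- x / 2 + y / 2) / 2 - w * b (- x / 2 - y / 2) / 2" using re by (simp add: x_def)
    then have "z = b x *\<^sub>R of_real w + b (- x / 2 + y / 2) *\<^sub>R (of_real w * \<omega>) +
        b (- x / 2 - y / 2) *\<^sub>R (of_real w * \<omega>\<^sup>2)"
      using im unfolding omega_square by (simp add: omega_eq complex_eq_iff algebra_simps)
    then show "z \<in> convex hull {of_real w, of_real w * \<omega>, of_real w * \<omega>\<^sup>2}"
      unfolding convex_hull_3 using sum z
      by (intro CollectI exI[of _ "b x"] exI[of _ "b (- x / 2 + y / 2)"] exI[of _ "b (- x / 2 - y / 2)"])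
        (simp add: b x_def y_def)
  qed
qed

lemma convex_trimmed_triangle: "convex (trimmed_triangle d)"
proof -
  have "trimmed_triangle d = cball 0 d \<inter> (\<Inter>k<3. {z. inner (\<omega> ^ k) z \<ge> - d / sqrt 3})"
    by (auto simp: trimmed_triangle_def Re_divide_eq_inner norm_power inner_commute)
  then show ?thesis by (simp add: convex_Int convex_INT convex_halfspace_ge)
qed

section \<open>The rounded hexagon\<close>

text \<open>For the hexagon of parameter \<open>a0\<close>, \<open>r\<close> is the circumradius, \<open>\<rho>\<close> the inradius of the equilateral
  triangle and \<open>h\<close> the distance from the centre to the lines that cut off the corners. That \<open>r / sqrt 3\<close>
  is this inradius is the choice of \<open>a0\<close>, which makes the side of the triangle equal to \<open>2 * r\<close>
  (\<open>hexagon_side\<close>). The symmetry reduces statements about all corners to the corner at the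
  positive real axis.\<close>

context
  fixes a r h \<rho> :: real
  assumes a: "a = a0" and r: "r = hex_radius a0" and \<rho>: "\<rho> = r / sqrt 3" and h: "h = 2 * \<rho> - a * sqrt 3 / 2"
begin

lemma hexagon_side: "hex_b a0 + 2 * a0 = 2 * r"
  using a0(3) hex_endpoint_dist_half[of a0] r by simp

lemma cut_point_coordinates: "cut_point a0 0 1 = Complex h (a / 2)" "cut_point a0 0 2 = Complex h (- a / 2)"
  unfolding cut_point_0 hexagon_side h \<rho> a by simp_all

lemma hexagon_radius_sq: "r\<^sup>2 = h\<^sup>2 + a\<^sup>2 / 4"
proof -
  have "r = norm (Complex h (a / 2))" unfolding cut_point_coordinates[symmetric] by (simp add: r hex_radius_def)
  then show ?thesis by (simp add: cmod_power2 power_divide)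
qed

lemma hexagon_pos: "0 < a" "0 < r" "0 < \<rho>" "\<rho> \<le> h" "a \<le> 2 * sqrt 3 * h"
proof -
  show a_pos: "0 < a" using a0_pos a by simp
  show r_pos: "0 < r" using hexagon_side side_pos[of a0] by simp
  then show \<rho>_pos: "0 < \<rho>" by (simp add: \<rho>)
  have "2 * r \<ge> 6 * a" using side_a0 hexagon_side a a_pos by (simp add: distrib_right)
  then have "sqrt 3 * \<rho> \<ge> 3 * a" by (simp add: \<rho>)
  moreover have "sqrt 3 * (a * sqrt 3) = 3 * a" by simp
  ultimately have "sqrt 3 * (a * sqrt 3) \<le> sqrt 3 * \<rho>" by linarith
  then have "\<rho> \<ge> a * sqrt 3" by (subst (asm) mult_le_cancel_left_pos) auto
  moreover have "a * sqrt 3 > 0" using a_pos by simp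
  ultimately show *: "\<rho> \<le> h" unfolding h by linarith
  have "a * 1 \<le> a * sqrt 3" using a_pos by (intro mult_left_mono) auto
  then have "a \<le> h" using \<open>\<rho> \<ge> a * sqrt 3\<close> * by linarith
  moreover have "1 \<le> 2 * sqrt 3" using real_sqrt_ge_one[of 3] by linarith
  then have "1 * h \<le> (2 * sqrt 3) * h" using * \<rho>_pos by (intro mult_right_mono) auto
  ultimately show "a \<le> 2 * sqrt 3 * h" by linarith
qed

lemma tri_vertex_omega: "tri_vertex a0 k = of_real (2 * \<rho>) * \<omega> ^ k"
  unfolding tri_vertex_def hexagon_side cis_third_multiple \<rho> by (simp add: scaleR_conv_of_real)

lemma tri_eq: "tri a0 = {z. \<forall>k<3. - \<rho> \<le> Re (z / \<omega> ^ k)}"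
proof -
  have "{..<3::nat} = {0, 1, 2}" by auto
  then have "tri_vertex a0 ` {..<3} = {of_real (2 * \<rho>), of_real (2 * \<rho>) * \<omega>, of_real (2 * \<rho>) * \<omega>\<^sup>2}"
    by (simp add: tri_vertex_omega)
  then show ?thesis
    unfolding tri_def using convex_hull_omega_orbit[of "2 * \<rho>"] hexagon_pos(3) by simp
qed

lemma tri_rotate: "z / \<omega> ^ k \<in> tri a0 \<longleftrightarrow> z \<in> tri a0"
  unfolding tri_eq mem_Collect_eq by (rule all_omega_shift[of "\<lambda>\<zeta>. - \<rho> \<le> Re \<zeta>"])

text \<open>In the triangle cut off from \<open>tri a0\<close> by the line \<open>Re z = h\<close>, the barycentric coordinate that
  belongs to the vertex of \<open>tri a0\<close> is the height \<open>u\<close> above the line relative to the height \<open>w\<close> of the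
  vertex; the difference of the two others is \<open>2 * Im z / a\<close>.\<close>

lemma mem_corner_0_iff:
  assumes z: "z \<in> tri a0"
  shows "z \<in> corner a0 0 \<longleftrightarrow> h \<le> Re z"
proof -
  define w where "w = 2 * \<rho> - h"
  have w: "w = a * sqrt 3 / 2" by (simp add: w_def h)
  have w_pos: "w > 0" using hexagon_pos(1) by (simp add: w)
  have corner: "corner a0 0 = convex hull {of_real (2 * \<rho>), Complex h (a / 2), Complex h (- a / 2)}"
    unfolding corner_def tri_vertex_omega by (simp only: add_0 power_0 mult_1_right cut_point_coordinates)
  show ?thesis
  proof
    assume "z \<in> corner a0 0"
    moreover have "convex hull {of_real (2 * \<rho>), Complex h (a / 2), Complex h (- a / 2)} \<subseteq> {z. h \<le> Re z}"
      using w_pos by (intro hull_minimal) (auto simp: w_def convex_halfspace_Re_ge)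
    ultimately show "h \<le> Re z" unfolding corner by blast
  next
    assume hz: "h \<le> Re z"
    define x y where "x = Re z" and "y = Im z"
    have "- \<rho> \<le> - x / 2 + sqrt 3 / 2 * y" "- \<rho> \<le> - x / 2 - sqrt 3 / 2 * y"
      using z unfolding tri_eq mem_Collect_eq all_less_3 by (simp_all add: div_omega x_def y_def)
    then have y: "sqrt 3 / 2 * y \<le> (2 * \<rho> - x) / 2" "- (sqrt 3 / 2 * y) \<le> (2 * \<rho> - x) / 2" by simp_all
    define u where "u = (x - h) / w"
    have u: "u \<ge> 0" "x = h + u * w" using hz w_pos by (simp_all add: u_def x_def)
    have yw: "sqrt 3 / 2 * y = w * (y / a)" using hexagon_pos(1) by (simp add: w)
    have "2 * \<rho> - x = w * (1 - u)" using u by (simp add: w_def algebra_simps)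
    then have "w * (y / a) \<le> w * ((1 - u) / 2)" "w * (- (y / a)) \<le> w * ((1 - u) / 2)"
      using y unfolding yw by simp_all
    then have "y / a \<le> (1 - u) / 2" "- (y / a) \<le> (1 - u) / 2"
      by (simp_all only: mult_le_cancel_left_pos[OF w_pos])
    then have nonneg: "0 \<le> (1 - u) / 2 + y / a" "0 \<le> (1 - u) / 2 - y / a" by linarith+
    have "Re z = u * (2 * \<rho>) + ((1 - u) / 2 + y / a) * h + ((1 - u) / 2 - y / a) * h"
      using u(2) by (simp add: x_def w_def algebra_simps)
    moreover have "Im z = ((1 - u) / 2 + y / a) * (a / 2) + ((1 - u) / 2 - y / a) * (- a / 2)"
      using hexagon_pos(1) by (simp add: y_def field_simps)
    ultimately have "z = u *\<^sub>R of_real (2 * \<rho>) + ((1 - u) / 2 + y / a) *\<^sub>R Complex h (a / 2) +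
        ((1 - u) / 2 - y / a) *\<^sub>R Complex h (- a / 2)"
      by (simp add: complex_eq_iff)
    then show "z \<in> corner a0 0"
      unfolding corner convex_hull_3 using u(1) nonneg
      by (intro CollectI exI[of _ u] exI[of _ "(1 - u) / 2 + y / a"] exI[of _ "(1 - u) / 2 - y / a"]) simp
  qed
qed

lemma mem_corner_iff: "z \<in> corner a0 k \<longleftrightarrow> z / \<omega> ^ k \<in> corner a0 0"
proof (induction k arbitrary: z)
  case (Suc k)
  have "z \<in> corner a0 (Suc k) \<longleftrightarrow> z / \<omega> \<in> corner a0 k"
    unfolding rot_corner[symmetric] \<omega>_def[symmetric]
    by (auto intro: image_eqI[of _ _ "z / \<omega>"])
  then show ?case using Suc[of "z / \<omega>"] by simp
qed simp

text \<open>Removing the closed corners leaves the points that satisfy the upper bounds strictly. Every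
  point of the closed hexagon is a limit of such points, obtained by shrinking it towards the
  centre.\<close>

lemma hexagon_eq: "hexagon a0 = {z. \<forall>k<3. - \<rho> \<le> Re (z / \<omega> ^ k) \<and> Re (z / \<omega> ^ k) \<le> h}"
proof -
  define X where "X = {z. \<forall>k<3. - \<rho> \<le> Re (z / \<omega> ^ k) \<and> Re (z / \<omega> ^ k) \<le> h}"
  have mem: "z \<in> corner a0 k \<longleftrightarrow> h \<le> Re (z / \<omega> ^ k)" if "z \<in> tri a0" for z k
    using mem_corner_0_iff[of "z / \<omega> ^ k"] that tri_rotate[of z k] mem_corner_iff[of z k] by simp
  have open_hex: "tri a0 - (\<Union>k<3. corner a0 k) =
      {z. \<forall>k<3. - \<rho> \<le> Re (z / \<omega> ^ k) \<and> Re (z / \<omega> ^ k) < h}"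
  proof (rule set_eqI)
    fix z
    have "z \<in> tri a0 - (\<Union>k<3. corner a0 k) \<longleftrightarrow> z \<in> tri a0 \<and> (\<forall>k<3. Re (z / \<omega> ^ k) < h)"
      using mem[of z] by (simp only: Diff_iff UN_iff lessThan_iff Bex_def not_le[symmetric]) blast
    then show "z \<in> tri a0 - (\<Union>k<3. corner a0 k) \<longleftrightarrow>
        z \<in> {z. \<forall>k<3. - \<rho> \<le> Re (z / \<omega> ^ k) \<and> Re (z / \<omega> ^ k) < h}"
      unfolding tri_eq mem_Collect_eq by blast
  qed
  have "closed X"
  proof -
    have "X = (\<Inter>k<3. {z. - \<rho> \<le> Re (z / \<omega> ^ k)} \<inter> {z. Re (z / \<omega> ^ k) \<le> h})"
      by (auto simp: X_def)
    moreover have "closed ({z. - \<rho> \<le> Re (z / \<omega> ^ k)} \<inter> {z. Re (z / \<omega> ^ k) \<le> h})" for k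
      by (intro closed_Int closed_Collect_le continuous_intros) auto
    ultimately show ?thesis by (simp add: closed_INT)
  qed
  moreover have "tri a0 - (\<Union>k<3. corner a0 k) \<subseteq> X"
    unfolding open_hex X_def by (auto intro: less_imp_le)
  ultimately have "hexagon a0 \<subseteq> X" unfolding hexagon_def by (intro closure_minimal)
  moreover have "z \<in> hexagon a0" if z: "z \<in> X" for z
  proof -
    have "(1 - t) *\<^sub>R z \<in> tri a0 - (\<Union>k<3. corner a0 k)" if t: "0 < t" "t < 1" for t
    proof -
      have "- \<rho> \<le> (1 - t) * x \<and> (1 - t) * x < h" if "- \<rho> \<le> x" "x \<le> h" for x
      proof
        have "(1 - t) * (- \<rho>) \<le> (1 - t) * x" "(1 - t) * x \<le> (1 - t) * h"
          using that t by (intro mult_left_mono; simp)+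
        moreover have "t * \<rho> > 0" "t * h > 0" using t hexagon_pos by simp_all
        ultimately show "- \<rho> \<le> (1 - t) * x" "(1 - t) * x < h" by (simp_all add: algebra_simps)
      qed
      moreover have "Re ((1 - t) *\<^sub>R z / \<omega> ^ k) = (1 - t) * Re (z / \<omega> ^ k)" for k
        by (simp only: scaleR_complex.sel(1)[symmetric]) (simp add: scaleR_conv_of_real)
      ultimately show ?thesis using z unfolding open_hex X_def by simp
    qed
    then have "\<forall>\<^sub>F t in at_right 0. (1 - t) *\<^sub>R z \<in> hexagon a0"
      unfolding hexagon_def using closure_subset
      by (intro eventually_mono[OF eventually_at_right_real[OF zero_less_one]]) fastforce
    moreover have "((\<lambda>t. (1 - t) *\<^sub>R z) \<longlongrightarrow> (1 - 0) *\<^sub>R z) (at_right 0)"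
      by (intro tendsto_intros)
    ultimately have "(1 - 0) *\<^sub>R z \<in> hexagon a0"
      by (intro Lim_in_closed_set[of "hexagon a0"]) (auto simp: hexagon_def)
    then show ?thesis by simp
  qed
  ultimately show ?thesis unfolding X_def by blast
qed

lemma Re_divide_omega_nonneg: "\<exists>k<3. 0 \<le> Re (\<zeta> / \<omega> ^ k)"
proof -
  have "Re \<zeta> + Re (\<zeta> / \<omega>) + Re (\<zeta> / \<omega>\<^sup>2) = 0" by (simp add: div_omega)
  then show ?thesis unfolding ex_less_3 by simp linarith
qed

text \<open>After a rotation the point \<open>(x, y)\<close> has \<open>0 \<le> x \<le> h\<close>. The edges through the vertex of the triangle
  bound \<open>\<bar>y\<bar>\<close> by \<open>(2 \<rho> - x) / \<surd>3\<close>, and this makes \<open>x\<^sup>2 + y\<^sup>2\<close> largest for \<open>x = h\<close>, that is, at a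
  vertex of the hexagon.\<close>

lemma hexagon_norm_le:
  assumes z: "z \<in> hexagon a0"
  shows "norm z \<le> r"
proof -
  obtain k where k: "k < 3" "0 \<le> Re (z / \<omega> ^ k)" using Re_divide_omega_nonneg by blast
  define \<zeta> where "\<zeta> = z / \<omega> ^ k"
  define x y where "x = Re \<zeta>" and "y = Im \<zeta>"
  have "\<zeta> \<in> hexagon a0"
    using z all_omega_shift[of "\<lambda>\<zeta>. - \<rho> \<le> Re \<zeta> \<and> Re \<zeta> \<le> h" z k] unfolding hexagon_eq \<zeta>_def mem_Collect_eq by blast
  then have hex: "x \<le> h" "- \<rho> \<le> - x / 2 + sqrt 3 / 2 * y" "- \<rho> \<le> - x / 2 - sqrt 3 / 2 * y"
    unfolding hexagon_eq mem_Collect_eq all_less_3 by (simp_all add: div_omega x_def y_def)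
  have "\<bar>sqrt 3 * y\<bar> \<le> 2 * \<rho> - x" using hex(2,3) by linarith
  then have "(sqrt 3 * y)\<^sup>2 \<le> (2 * \<rho> - x)\<^sup>2" by (metis abs_ge_zero power2_abs power_mono)
  then have y2: "3 * y\<^sup>2 \<le> (2 * \<rho> - x)\<^sup>2" by (simp add: power_mult_distrib)
  have "0 \<le> (h - x) * (h + x - \<rho>)" using hex(1) k(2) hexagon_pos(4) by (simp add: x_def \<zeta>_def)
  then have "3 * x\<^sup>2 + (2 * \<rho> - x)\<^sup>2 \<le> 3 * h\<^sup>2 + (2 * \<rho> - h)\<^sup>2"
    by (simp add: power2_eq_square algebra_simps)
  moreover have "(2 * \<rho> - h)\<^sup>2 = 3 * (a\<^sup>2 / 4)" by (simp add: h power_divide power_mult_distrib)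
  ultimately have "x\<^sup>2 + y\<^sup>2 \<le> r\<^sup>2" using y2 unfolding hexagon_radius_sq by linarith
  then have "(norm \<zeta>)\<^sup>2 \<le> r\<^sup>2" by (simp add: cmod_power2 x_def y_def)
  then have "norm \<zeta> \<le> r" by (rule power2_le_imp_le) (use hexagon_pos(2) in simp)
  then show ?thesis by (simp add: \<zeta>_def norm_divide norm_power)
qed

text \<open>In terms of \<open>S = s + t\<close> and \<open>D = \<bar>s - t\<bar>\<close> a point of the arc is \<open>(h S, \<plusminus> a D / 2)\<close>. Moving along the arc
  from its endpoint, where \<open>S = D = 1\<close>, increases \<open>S\<close> and decreases \<open>D\<close>; the equation of the circle
  compares the two changes and shows that the arc stays inside the triangle.\<close>

lemma arc_subset:
  assumes "z \<in> minor_arc r (cut_point a0 0 1) (cut_point a0 0 2)"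
  shows "z \<in> trimmed_triangle r"
proof -
  obtain s t where st: "s \<ge> 0" "t \<ge> 0" "z = s *\<^sub>R Complex h (a / 2) + t *\<^sub>R Complex h (- a / 2)" "norm z = r"
    using assms unfolding minor_arc_def cut_point_coordinates by auto
  define S D where "S = s + t" and "D = \<bar>s - t\<bar>"
  have DS: "0 \<le> D" "D \<le> S" using st by (auto simp: S_def D_def)
  have x: "Re z = h * S" and y: "\<bar>Im z\<bar> = a / 2 * D"
  proof -
    show "Re z = h * S" by (simp add: st(3) S_def algebra_simps)
    have "Im z = a / 2 * (s - t)" by (simp add: st(3) algebra_simps)
    then have "\<bar>Im z\<bar> = \<bar>a / 2\<bar> * D" by (simp only: D_def abs_mult)
    then show "\<bar>Im z\<bar> = a / 2 * D" using hexagon_pos(1) by simp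
  qed
  have "(Re z)\<^sup>2 + \<bar>Im z\<bar>\<^sup>2 = h\<^sup>2 + a\<^sup>2 / 4"
    unfolding hexagon_radius_sq[symmetric] st(4)[symmetric] by (simp add: cmod_power2)
  then have eq: "h\<^sup>2 * (S\<^sup>2 - 1) = a\<^sup>2 / 4 * (1 - D\<^sup>2)"
    unfolding x y by (simp add: power_mult_distrib power_divide algebra_simps)
  have hp: "h > 0" using hexagon_pos(3,4) by linarith
  have D1: "D \<le> 1"
  proof (rule ccontr)
    assume "\<not> D \<le> 1"
    then have "S\<^sup>2 > 1" "D\<^sup>2 > 1" using DS by (auto simp: power_strict_mono one_less_power)
    then have "h\<^sup>2 * (S\<^sup>2 - 1) > 0" "a\<^sup>2 / 4 * (1 - D\<^sup>2) < 0" using hp hexagon_pos(1) by (auto simp: mult_pos_neg)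
    then show False using eq by simp
  qed
  have "4 * h * (S + 1) * (h * (S - 1)) = a * (1 - D) * (a * (1 + D))"
    using eq by (simp add: power2_eq_square algebra_simps)
  also have "\<dots> \<le> a * (1 - D) * (2 * sqrt 3 * h * (1 + S))"
    using D1 DS hexagon_pos(1,5) hp by (intro mult_left_mono mult_mono) auto
  also have "\<dots> = 4 * h * (S + 1) * (sqrt 3 / 2 * (a * (1 - D)))" by (simp add: algebra_simps)
  finally have "h * (S - 1) \<le> sqrt 3 / 2 * (a * (1 - D))"
    using hp DS by (subst (asm) mult_le_cancel_left_pos) auto
  then have "Re z / 2 + sqrt 3 / 2 * \<bar>Im z\<bar> \<le> h / 2 + sqrt 3 * a / 4"
    unfolding x y by (simp add: algebra_simps)
  also have "\<dots> = \<rho>" by (simp add: h field_simps)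
  finally have "Re z / 2 + sqrt 3 / 2 * \<bar>Im z\<bar> \<le> \<rho>" .
  moreover have "sqrt 3 / 2 * Im z \<le> sqrt 3 / 2 * \<bar>Im z\<bar>" "- (sqrt 3 / 2 * \<bar>Im z\<bar>) \<le> sqrt 3 / 2 * Im z"
    by (auto simp: abs_if)
  ultimately have "- \<rho> \<le> - Re z / 2 + sqrt 3 / 2 * Im z" "- \<rho> \<le> - Re z / 2 - sqrt 3 / 2 * Im z" by linarith+
  moreover have "- \<rho> \<le> Re z" using x hp DS hexagon_pos(3) by (smt (verit) mult_nonneg_nonneg)
  ultimately show ?thesis
    unfolding trimmed_triangle_def mem_Collect_eq all_less_3
    using st(4) by (simp add: div_omega \<rho>)
qed

text \<open>On the horizontal line through \<open>z\<close>, the point \<open>z\<close> lies between the chord, at real part \<open>h\<close>, and the arc,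
  at real part \<open>q\<close>.\<close>

lemma cap_subset:
  assumes z: "norm z \<le> r" "h < Re z"
  shows "z \<in> convex hull minor_arc r (cut_point a0 0 1) (cut_point a0 0 2)" (is "_ \<in> convex hull ?arc")
proof -
  have hp: "h > 0" using hexagon_pos(3,4) by linarith
  have "(Re z)\<^sup>2 + (Im z)\<^sup>2 \<le> r\<^sup>2"
    using power_mono[OF z(1) norm_ge_zero, of 2] by (simp add: cmod_power2)
  moreover have "h\<^sup>2 < (Re z)\<^sup>2" using z(2) hp by (intro power_strict_mono) auto
  ultimately have y2: "(Im z)\<^sup>2 \<le> (a / 2)\<^sup>2" and xq: "(Re z)\<^sup>2 \<le> r\<^sup>2 - (Im z)\<^sup>2"
    unfolding hexagon_radius_sq by (simp_all add: power_divide)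
  have y: "\<bar>Im z\<bar> \<le> a / 2" by (rule power2_le_imp_le) (use y2 hexagon_pos(1) in simp_all)
  define q where "q = sqrt (r\<^sup>2 - (Im z)\<^sup>2)"
  have q: "Re z \<le> q" using xq z(2) hp by (simp add: q_def real_le_rsqrt)
  have q2: "q\<^sup>2 + (Im z)\<^sup>2 = r\<^sup>2" using order_trans[OF zero_le_power2 xq] by (simp add: q_def)
  have in_arc: "Complex q v \<in> ?arc" if "v = Im z" for v
  proof -
    define s t where "s = (q / h + 2 * v / a) / 2" and "t = (q / h - 2 * v / a) / 2"
    have "q / h \<ge> 1" using q z(2) hp by simp
    moreover have "\<bar>2 * v / a\<bar> \<le> 1" using y hexagon_pos(1) that by simp
    ultimately have "0 \<le> q / h + 2 * v / a" "0 \<le> q / h - 2 * v / a" by linarith+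
    then have "s \<ge> 0" "t \<ge> 0" by (simp_all only: s_def t_def divide_nonneg_pos zero_less_numeral)
    moreover have "Complex q v = s *\<^sub>R Complex h (a / 2) + t *\<^sub>R Complex h (- a / 2)"
      using hp hexagon_pos(1) by (simp add: complex_eq_iff s_def t_def field_simps)
    moreover have "norm (Complex q v) = r"
      using q2 hexagon_pos(2) that by (simp add: complex_norm)
    ultimately show ?thesis unfolding minor_arc_def cut_point_coordinates by auto
  qed
  have ends: "cut_point a0 0 1 \<in> ?arc" "cut_point a0 0 2 \<in> ?arc"
  proof -
    have "norm (cut_point a0 0 1) = r" "norm (cut_point a0 0 2) = r"
      by (simp_all only: r cut_point_norm[of a0 0, unfolded add_0 dist_0_norm])
    moreover have "\<exists>s\<ge>0. \<exists>t\<ge>0. x = s *\<^sub>R x + t *\<^sub>R y" "\<exists>s\<ge>0. \<exists>t\<ge>0. y = s *\<^sub>R x + t *\<^sub>R y" for x y :: complex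
      by (rule exI[of _ 1], simp, rule exI[of _ 0], simp) (rule exI[of _ 0], simp, rule exI[of _ 1], simp)
    ultimately show "cut_point a0 0 1 \<in> ?arc" "cut_point a0 0 2 \<in> ?arc" unfolding minor_arc_def by auto
  qed
  have cv: "convex (convex hull ?arc)" by (rule convex_convex_hull)
  have "Complex h (Im z) \<in> convex hull ?arc"
  proof -
    have "(1/2 + Im z / a) *\<^sub>R cut_point a0 0 1 + (1/2 - Im z / a) *\<^sub>R cut_point a0 0 2 \<in> convex hull ?arc"
      using y hexagon_pos(1) by (intro convexD[OF cv] hull_inc ends) (auto simp: field_simps abs_le_iff)
    also have "(1/2 + Im z / a) *\<^sub>R cut_point a0 0 1 + (1/2 - Im z / a) *\<^sub>R cut_point a0 0 2 = Complex h (Im z)"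
      unfolding cut_point_coordinates using hexagon_pos(1) by (simp add: complex_eq_iff field_simps)
    finally show ?thesis .
  qed
  moreover have "Complex q (Im z) \<in> convex hull ?arc" by (intro hull_inc in_arc) simp
  moreover have "z \<in> closed_segment (Complex h (Im z)) (Complex q (Im z))"
  proof -
    define t where "t = (Re z - h) / (q - h)"
    have "0 \<le> t" "t \<le> 1" "Re z = h + t * (q - h)" using z(2) q by (simp_all add: t_def)
    then show ?thesis
      unfolding closed_segment_def by (intro CollectI exI[of _ t]) (simp add: complex_eq_iff algebra_simps)
  qed
  ultimately show ?thesis using convex_contains_segment[of "convex hull ?arc"] cv by blast
qed

lemma rounded_hexagon_eq_trimmed: "rounded_hexagon = trimmed_triangle r"
proof -
  define A where "A = convex hull minor_arc r (cut_point a0 0 1) (cut_point a0 0 2)"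
  have cut: "cut_point a0 k (k + j) = \<omega> ^ k * cut_point a0 0 j" for k j
    by (induction k) (simp_all add: cut_point_rot \<omega>_def[symmetric] mult.assoc)
  have hull: "convex hull minor_arc (hex_radius a0) (cut_point a0 k (k + 1)) (cut_point a0 k (k + 2)) =
      (\<lambda>z. \<omega> ^ k * z) ` A" for k
    unfolding cut A_def cis_third_multiple[symmetric] rot_minor_arc[symmetric] r
    by (rule convex_hull_linear_image[OF linear_cis, symmetric])
  have mem: "z \<in> (\<lambda>z. \<omega> ^ k * z) ` A \<longleftrightarrow> z / \<omega> ^ k \<in> A" for z k
    by (force simp: image_iff)
  have "z \<in> trimmed_triangle r \<longleftrightarrow> z \<in> hexagon a0 \<or> (\<exists>k<3. z / \<omega> ^ k \<in> A)" for z
  proof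
    assume z: "z \<in> trimmed_triangle r"
    show "z \<in> hexagon a0 \<or> (\<exists>k<3. z / \<omega> ^ k \<in> A)"
    proof (cases "z \<in> hexagon a0")
      case False
      then obtain k where "k < 3" "h < Re (z / \<omega> ^ k)"
        using z unfolding hexagon_eq trimmed_triangle_def by (auto simp: \<rho> not_le)
      moreover have "norm (z / \<omega> ^ k) \<le> r" using z by (simp add: trimmed_triangle_def norm_divide norm_power)
      ultimately show ?thesis using cap_subset[of "z / \<omega> ^ k"] by (auto simp: A_def)
    qed simp
  next
    assume "z \<in> hexagon a0 \<or> (\<exists>k<3. z / \<omega> ^ k \<in> A)"
    then show "z \<in> trimmed_triangle r"
    proof
      assume "z \<in> hexagon a0"
      then show ?thesis using hexagon_norm_le[of z] by (auto simp: hexagon_eq trimmed_triangle_def \<rho>)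
    next
      assume "\<exists>k<3. z / \<omega> ^ k \<in> A"
      moreover have "A \<subseteq> trimmed_triangle r"
        unfolding A_def using arc_subset by (intro hull_minimal convex_trimmed_triangle) auto
      ultimately show ?thesis using trimmed_triangle_rotate by blast
    qed
  qed
  then show ?thesis
    unfolding rounded_hexagon_def hull set_eq_iff Un_iff UN_iff mem Bex_def lessThan_iff by blast
qed

end

lemma rounded_hexagon_eq: "rounded_hexagon = trimmed_triangle (hex_radius a0)"
  by (rule rounded_hexagon_eq_trimmed[OF refl refl refl refl])

section \<open>Independence of the centre\<close>

text \<open>The vectors from \<open>p\<close> to the three rotated copies of \<open>x\<close> have sum zero, so one of them makes an angle
  of at least 90 degrees with the vector from \<open>p\<close> to \<open>q\<close>.\<close>

lemma rot3_center_farther: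
  assumes "rot3_center A p" "x \<in> A"
  shows "\<exists>y\<in>A. (dist p x)\<^sup>2 + (dist p q)\<^sup>2 \<le> (dist q y)\<^sup>2"
proof -
  define w c where "w = x - p" and "c = q - p"
  have "inner c (w + \<omega> * w + \<omega>\<^sup>2 * w) = 0"
    using omega_sum by (metis distrib_right inner_zero_right mult_1 mult_zero_left)
  then have "inner c w + inner c (\<omega> * w) + inner c (\<omega>\<^sup>2 * w) = 0" by (simp add: inner_add_right)
  then have "\<exists>k<3. inner c (\<omega> ^ k * w) \<le> 0" unfolding ex_less_3 by simp linarith
  then obtain k where k: "inner c (\<omega> ^ k * w) \<le> 0" by blast
  have "(dist q (p + \<omega> ^ k * w))\<^sup>2 = (norm (\<omega> ^ k * w - c))\<^sup>2"
    by (simp add: dist_norm c_def norm_minus_commute algebra_simps)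
  also have "\<dots> = (norm (\<omega> ^ k * w))\<^sup>2 + (norm c)\<^sup>2 - 2 * inner c (\<omega> ^ k * w)"
    by (simp add: power2_norm_eq_inner inner_diff inner_commute)
  also have "\<dots> \<ge> (norm w)\<^sup>2 + (norm c)\<^sup>2" using k by (simp add: norm_mult norm_power)
  finally have "(dist p x)\<^sup>2 + (dist p q)\<^sup>2 \<le> (dist q (p + \<omega> ^ k * w))\<^sup>2"
    by (simp add: dist_norm w_def c_def norm_minus_commute)
  then show ?thesis using rot3_center_mem[OF assms, of k] by (auto simp: w_def)
qed

lemma rigid_motion_bij:
  assumes "rigid_motion f"
  shows "bij f"
proof -
  have "orthogonal_transformation (\<lambda>z. f z - f 0)"
    using assms unfolding orthogonal_transformation_isometry rigid_motion_def by (simp add: dist_norm)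
  then have "bij (\<lambda>z. f z - f 0)" by (rule orthogonal_transformation_bij)
  then have "bij ((\<lambda>z. f 0 + z) \<circ> (\<lambda>z. f z - f 0))"
    by (intro bij_comp) (auto simp: bij_plus)
  then show ?thesis by (simp add: comp_def)
qed

text \<open>By \<open>rot3_center_farther\<close> the centre is the only point for which the greatest distance to the
  points of \<open>A\<close> is minimal. This description is invariant under rigid motions.\<close>

lemma rot3_center_rigid_motion:
  assumes f: "rigid_motion f" and A: "compact A" "rot3_center A p" "rot3_center (f ` A) q"
  shows "q = f p"
proof -
  have d: "dist (f x) (f y) = dist x y" for x y using f by (simp add: rigid_motion_def)
  obtain q' where q': "q = f q'" using rigid_motion_bij[OF f] by (metis bij_pointE)
  have ne: "A \<noteq> {}" using A(2) by (auto simp: rot3_center_def)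
  obtain x where x: "x \<in> A" "outer_radius A p = dist p x" using outer_radius_attained[OF A(1) ne] .
  obtain y where y: "y \<in> A" "outer_radius A q' = dist q' y" using outer_radius_attained[OF A(1) ne] .
  have bd: "bounded A" using A(1) by (rule compact_imp_bounded)
  have "(dist p x)\<^sup>2 + (dist p q')\<^sup>2 \<le> (dist q' y)\<^sup>2"
  proof -
    obtain z where z: "z \<in> A" "(dist p x)\<^sup>2 + (dist p q')\<^sup>2 \<le> (dist q' z)\<^sup>2"
      using rot3_center_farther[OF A(2) x(1)] by blast
    have "dist q' z \<le> dist q' y" using dist_le_outer_radius[OF bd z(1), of q'] y(2) by simp
    then show ?thesis using z(2) by (meson order_trans power_mono zero_le_dist)
  qed
  moreover have "(dist q' y)\<^sup>2 + (dist q' p)\<^sup>2 \<le> (dist p x)\<^sup>2"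
  proof -
    obtain z where z: "z \<in> A" "(dist q (f y))\<^sup>2 + (dist q (f p))\<^sup>2 \<le> (dist (f p) (f z))\<^sup>2"
      using rot3_center_farther[OF A(3) imageI[OF y(1)], of "f p"] by blast
    have "dist p z \<le> dist p x" using dist_le_outer_radius[OF bd z(1), of p] x(2) by simp
    then have "(dist p z)\<^sup>2 \<le> (dist p x)\<^sup>2" by (intro power_mono) auto
    then show ?thesis using z(2) unfolding q' d by linarith
  qed
  ultimately have "(dist p q')\<^sup>2 \<le> 0" unfolding dist_commute[of q' p] by linarith
  then show ?thesis by (simp add: q')
qed

lemma rigid_motion_frontier:
  assumes "rigid_motion f"
  shows "frontier (f ` A) = f ` frontier A"
proof -
  define g where "g z = f z - f 0" for z
  have g: "orthogonal_transformation g"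
    using assms unfolding orthogonal_transformation_isometry rigid_motion_def g_def by (simp add: dist_norm)
  have "bij g" using g by (rule orthogonal_transformation_bij)
  have "linear g" using g by (rule orthogonal_transformation_linear)
  have fg: "f ` S = (\<lambda>z. f 0 + z) ` g ` S" for S by (simp add: g_def image_image)
  have "frontier (g ` A) = g ` frontier A"
    using \<open>bij g\<close> \<open>linear g\<close>
    by (simp add: frontier_def closure_injective_linear_image interior_bijective_linear_image
        bij_is_inj image_set_diff)
  then show ?thesis unfolding fg by (simp only: frontier_translation)
qed

lemma max_rel_diameter_rigid_motion:
  assumes f: "rigid_motion f"
    and A: "planar_convex_body A" "standard_trisection A T"
    and fA: "planar_convex_body (f ` A)" "standard_trisection (f ` A) T'"
  shows "max_rel_diameter T' = max_rel_diameter T"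
proof -
  have d: "dist (f x) (f y) = dist x y" for x y using f by (simp add: rigid_motion_def)
  obtain p m where T: "rot3_center A p" "m \<in> frontier A" "dist p m = infdist p (frontier A)"
      "T = trisection A p m"
    using A(2) unfolding standard_trisection_def by blast
  obtain q n where T': "rot3_center (f ` A) q" "n \<in> frontier (f ` A)"
      "dist q n = infdist q (frontier (f ` A))" "T' = trisection (f ` A) q n"
    using fA(2) unfolding standard_trisection_def by blast
  have q: "q = f p"
    using rot3_center_rigid_motion[OF f _ T(1) T'(1)] A(1) by (simp add: planar_convex_body_def)
  have "infdist q (frontier (f ` A)) = infdist p (frontier A)"
    unfolding rigid_motion_frontier[OF f] q by (simp add: infdist_def image_image d)
  moreover have "outer_radius (f ` A) q = outer_radius A p"
    by (simp add: outer_radius_def q image_image d)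
  ultimately show ?thesis
    unfolding T(4) T'(4) max_rel_diameter_trisection[OF A(1) T(1-3)]
      max_rel_diameter_trisection[OF fA(1) T'(1-3)] by simp
qed

section \<open>Area and trisection of the trimmed triangle\<close>

lemma ball_subset_trimmed_triangle:
  assumes "0 < d"
  shows "ball 0 (d / sqrt 3) \<subseteq> trimmed_triangle d"
proof
  fix z assume z: "z \<in> ball (0 :: complex) (d / sqrt 3)"
  have "d / sqrt 3 \<le> d / 1" using assms by (intro divide_left_mono) auto
  moreover have "- d / sqrt 3 \<le> Re (z / \<omega> ^ k)" for k
    using abs_Re_le_cmod[of "z / \<omega> ^ k"] z by (simp add: norm_divide norm_power)
  ultimately show "z \<in> trimmed_triangle d" using z by (simp add: trimmed_triangle_def)
qed

lemma compact_trimmed_triangle: "compact (trimmed_triangle d)"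
proof -
  have "trimmed_triangle d = cball 0 d \<inter> (\<Inter>k<3. {z. - d / sqrt 3 \<le> Re (z / \<omega> ^ k)})"
    by (auto simp: trimmed_triangle_def)
  moreover have "closed {z. - d / sqrt 3 \<le> Re (z / \<omega> ^ k)}" for k
    by (intro closed_Collect_le continuous_intros) auto
  ultimately show ?thesis by (simp add: compact_Int_closed closed_INT)
qed

lemma planar_convex_body_trimmed_triangle:
  assumes "0 < d"
  shows "planar_convex_body (trimmed_triangle d)"
proof -
  have "0 \<in> ball (0 :: complex) (d / sqrt 3)" using assms by simp
  also have "\<dots> \<subseteq> interior (trimmed_triangle d)"
    by (intro interior_maximal ball_subset_trimmed_triangle assms) simp
  finally show ?thesis
    by (auto simp: planar_convex_body_def convex_trimmed_triangle compact_trimmed_triangle)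
qed

lemma scaleR_trimmed_triangle:
  assumes "0 < c"
  shows "(\<lambda>z. c *\<^sub>R z) ` trimmed_triangle d = trimmed_triangle (c * d)"
proof -
  have mem: "c *\<^sub>R z \<in> trimmed_triangle (c * d) \<longleftrightarrow> z \<in> trimmed_triangle d" for z
  proof -
    have "Re (c *\<^sub>R z / w) = c * Re (z / w)" for w
      by (simp only: scaleR_complex.sel(1)[symmetric]) (simp add: scaleR_conv_of_real)
    moreover have "- (c * d) / sqrt 3 \<le> c * t \<longleftrightarrow> - d / sqrt 3 \<le> t" for t
    proof -
      have "- (c * d) / sqrt 3 = c * (- d / sqrt 3)" by simp
      then show ?thesis by (simp only: mult_le_cancel_left_pos[OF assms])
    qed
    ultimately show ?thesis using assms by (simp add: trimmed_triangle_def)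
  qed
  have "z \<in> (\<lambda>z. c *\<^sub>R z) ` trimmed_triangle d" if "z \<in> trimmed_triangle (c * d)" for z
    using mem[of "(1 / c) *\<^sub>R z"] that assms by (intro image_eqI[of _ _ "(1 / c) *\<^sub>R z"]) simp_all
  then show ?thesis using mem by blast
qed

lemma measure_trimmed_triangle:
  assumes "0 < d"
  shows "measure lebesgue (trimmed_triangle d) = d\<^sup>2 * measure lebesgue (trimmed_triangle 1)"
  using measure_lebesgue_affine[of d 0 "trimmed_triangle 1"] scaleR_trimmed_triangle[OF assms, of 1] assms
  by simp

lemma measure_trimmed_triangle_pos:
  assumes "0 < d"
  shows "0 < measure lebesgue (trimmed_triangle d)"
proof -
  have "0 < measure lebesgue (ball (0 :: complex) (d / sqrt 3))"
    using assms by (simp add: content_ball_gt_0_iff)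
  also have "\<dots> \<le> measure lebesgue (trimmed_triangle d)"
    by (intro measure_mono_fmeasurable ball_subset_trimmed_triangle assms)
      (auto simp: compact_trimmed_triangle lmeasurable_compact)
  finally show ?thesis .
qed

lemma H_tilde_is_trimmed_triangle:
  obtains d where "0 < d" "H_tilde = trimmed_triangle d" "measure lebesgue H_tilde = 1"
proof -
  define r where "r = hex_radius a0"
  have r: "0 < r" using a0(3) hex_endpoint_dist_half[of a0] side_pos[of a0] by (simp add: r_def)
  define A where "A = measure lebesgue (trimmed_triangle r)"
  have A: "0 < A" unfolding A_def by (rule measure_trimmed_triangle_pos[OF r])
  have H: "H_tilde = trimmed_triangle (1 / sqrt A * r)"
    using scaleR_trimmed_triangle[of "1 / sqrt A" r] A
    unfolding H_tilde_def rounded_hexagon_eq A_def r_def by simp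
  have "0 < 1 / sqrt A * r" using A r by simp
  then have "measure lebesgue H_tilde = (1 / sqrt A * r)\<^sup>2 * measure lebesgue (trimmed_triangle 1)"
    unfolding H by (rule measure_trimmed_triangle)
  also have "\<dots> = (1 / sqrt A)\<^sup>2 * (r\<^sup>2 * measure lebesgue (trimmed_triangle 1))"
    by (simp only: power_mult_distrib mult.assoc)
  also have "r\<^sup>2 * measure lebesgue (trimmed_triangle 1) = A"
    unfolding A_def by (rule measure_trimmed_triangle[OF r, symmetric])
  finally have "measure lebesgue H_tilde = 1" using A by (simp add: power_divide)
  then show ?thesis using that[of "1 / sqrt A * r"] H A r by simp
qed

text \<open>The point \<open>v\<close> of the closed body is on an edge line of the triangle, so that it is not interior.\<close>

lemma infdist_frontier_trimmed_triangle:
  assumes "0 < d"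
  shows "infdist 0 (frontier (trimmed_triangle d)) \<le> d / sqrt 3"
proof -
  define v :: complex where "v = of_real (- d / sqrt 3)"
  have "v \<notin> interior (trimmed_triangle d)"
  proof
    assume "v \<in> interior (trimmed_triangle d)"
    then obtain e where e: "e > 0" "ball v e \<subseteq> trimmed_triangle d" using mem_interior by blast
    have "v - of_real (e / 2) \<in> trimmed_triangle d" using e by (auto simp: dist_norm)
    then have "\<forall>k<3. - d / sqrt 3 \<le> Re ((v - of_real (e / 2)) / \<omega> ^ k)"
      unfolding trimmed_triangle_def by simp
    then have "- d / sqrt 3 \<le> Re ((v - of_real (e / 2)) / \<omega> ^ 0)" unfolding all_less_3 by (rule conjunct1)
    then show False using e(1) by (simp add: v_def)
  qed
  moreover have "v \<in> closure (trimmed_triangle d)"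
  proof -
    have "closure (ball 0 (d / sqrt 3)) \<subseteq> closure (trimmed_triangle d)"
      by (intro closure_mono ball_subset_trimmed_triangle assms)
    moreover have "v \<in> cball 0 (d / sqrt 3)" using assms by (simp add: v_def norm_divide)
    ultimately show ?thesis using assms by auto
  qed
  ultimately have "infdist 0 (frontier (trimmed_triangle d)) \<le> dist 0 v"
    by (intro infdist_le) (simp add: frontier_def)
  then show ?thesis using assms by (simp add: v_def norm_divide)
qed

lemma max_rel_diameter_trimmed_triangle_le:
  assumes d: "0 < d" and center: "rot3_center (trimmed_triangle d) 0"
    and T: "standard_trisection (trimmed_triangle d) T"
  shows "max_rel_diameter T \<le> d"
proof -
  note body = planar_convex_body_trimmed_triangle[OF d]
  have nonempty: "trimmed_triangle d \<noteq> {}" using center by (auto simp: rot3_center_def)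
  obtain p m where m: "rot3_center (trimmed_triangle d) p" "m \<in> frontier (trimmed_triangle d)"
      "dist p m = infdist p (frontier (trimmed_triangle d))" "T = trisection (trimmed_triangle d) p m"
    using T unfolding standard_trisection_def by blast
  have "rigid_motion id" by (simp add: rigid_motion_def)
  from rot3_center_rigid_motion[OF this compact_trimmed_triangle center] have "p = 0" using m(1) by simp
  moreover have "sqrt 3 * infdist 0 (frontier (trimmed_triangle d)) \<le> d"
    using infdist_frontier_trimmed_triangle[OF d] by (simp add: field_simps)
  moreover have "outer_radius (trimmed_triangle d) 0 \<le> d"
    using nonempty by (rule outer_radius_le) (simp add: trimmed_triangle_def)
  ultimately show ?thesis
    unfolding m(4) max_rel_diameter_trisection[OF body m(1-3)] by simp
qed

text \<open>Let \<open>D\<close> be the maximum relative diameter. Then \<open>C\<close> lies in a congruent copy of \<open>trimmed_triangle D\<close>, whose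
  area is \<open>(D / d)\<^sup>2\<close>. Hence \<open>D \<ge> d\<close>, and for \<open>D = d\<close> the areas agree.\<close>

lemma trisection_area_bound:
  assumes C: "planar_convex_body C" "measure lebesgue C = 1" "standard_trisection C T"
    and H: "0 < d" "measure lebesgue (trimmed_triangle d) = 1"
  shows "d \<le> max_rel_diameter T"
    and "max_rel_diameter T = d \<Longrightarrow> \<exists>f. rigid_motion f \<and> C = f ` trimmed_triangle d"
proof -
  define D where "D = max_rel_diameter T"
  obtain p m where m: "rot3_center C p" "m \<in> frontier C" "dist p m = infdist p (frontier C)"
      "T = trisection C p m"
    using C(3) unfolding standard_trisection_def by blast
  have D: "D = max (sqrt 3 * infdist p (frontier C)) (outer_radius C p)"
    unfolding D_def m(4) by (rule max_rel_diameter_trisection[OF C(1) m(1-3)])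
  obtain u where u: "norm u = 1" and sub: "C \<subseteq> (\<lambda>z. p + u * z) ` trimmed_triangle D"
    using subset_trimmed_triangle[OF C(1) m(1), of D] D by auto
  define f where "f = (\<lambda>z. p + u * z)"
  have f: "dist (f x) (f y) = dist x y" for x y
    using u by (simp add: f_def dist_norm norm_mult flip: right_diff_distrib)
  have sub: "C \<subseteq> f ` trimmed_triangle D" using sub by (simp add: f_def)
  have p: "p \<in> interior C"
    using rot3_center_interior[OF _ _ m(1)] C(1) by (simp add: planar_convex_body_def)
  have "0 < infdist p (frontier C)"
    using C(1) p by (intro cball_infdist_frontier_subset(1)) (simp_all add: planar_convex_body_def)
  then have "0 < sqrt 3 * infdist p (frontier C)" by simp
  then have D_pos: "0 < D" using D by linarith
  have lip: "dist (f x) (f y) \<le> dist x y" for x y by (simp add: f)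
  have le: "measure lebesgue (f ` trimmed_triangle D) \<le> measure lebesgue (trimmed_triangle D)"
    by (rule nonexpansive_measure_le[OF lip compact_trimmed_triangle convex_trimmed_triangle])
  have cf: "continuous_on X f" for X unfolding f_def by (intro continuous_intros)
  have cpt: "compact (f ` trimmed_triangle D)"
    by (intro compact_continuous_image cf compact_trimmed_triangle)
  have "1 \<le> measure lebesgue (f ` trimmed_triangle D)"
    unfolding C(2)[symmetric] using C(1) cpt sub
    by (intro measure_mono_fmeasurable)
      (auto simp: planar_convex_body_def lmeasurable_compact fmeasurableD)
  then have ge: "1 \<le> measure lebesgue (trimmed_triangle D)" using le by simp
  define A where "A = measure lebesgue (trimmed_triangle 1)"
  have A: "0 < A" unfolding A_def by (rule measure_trimmed_triangle_pos) simp
  have "d\<^sup>2 * A \<le> D\<^sup>2 * A"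
    using ge H measure_trimmed_triangle[OF D_pos] measure_trimmed_triangle[OF H(1)] by (simp add: A_def)
  then have "d\<^sup>2 \<le> D\<^sup>2" using A by simp
  then show "d \<le> max_rel_diameter T"
    unfolding D_def[symmetric] by (rule power2_le_imp_le) (use D_pos in simp)
  assume "max_rel_diameter T = d"
  then have Dd: "D = d" by (simp add: D_def)
  have cvx: "convex (f ` trimmed_triangle D)"
  proof -
    have "f ` trimmed_triangle D = (\<lambda>z. p + z) ` (\<lambda>z. u * z) ` trimmed_triangle D"
      by (simp add: f_def image_image)
    then show ?thesis
      by (simp add: convex_translation convex_linear_image[OF linear_mult_left convex_trimmed_triangle])
  qed
  have "C = f ` trimmed_triangle D"
  proof (rule convex_body_eq_if_measure_eq[OF _ sub cpt cvx])
    show "closed C" using C(1) by (simp add: planar_convex_body_def compact_imp_closed)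
    show "interior (f ` trimmed_triangle D) \<noteq> {}" using interior_mono[OF sub] p by blast
    show "measure lebesgue (f ` trimmed_triangle D) \<le> measure lebesgue C"
      using le C(2) H(2) Dd by simp
  qed
  then show "\<exists>f. rigid_motion f \<and> C = f ` trimmed_triangle d"
    using f Dd by (auto simp: rigid_motion_def)
qed

section \<open>The optimal trisected body\<close>

text \<open>The area bound applies to \<open>H_tilde\<close> as well and gives the lower of the two estimates that
  determine its maximum relative diameter.\<close>

theorem theorem4p7:
  fixes C :: "complex set" and T T' :: "complex set set"
  assumes "planar_convex_body C"
    and "rot3_symmetric C"
    and "measure lebesgue C = 1"
    and "standard_trisection C T"
    and "standard_trisection H_tilde T'"
  shows "max_rel_diameter T' \<le> max_rel_diameter T \<and>
    (max_rel_diameter T' = max_rel_diameter T \<longleftrightarrow> (\<exists>f. rigid_motion f \<and> C = f ` H_tilde))"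
proof -
  obtain d where d: "0 < d" "H_tilde = trimmed_triangle d" "measure lebesgue H_tilde = 1"
    by (rule H_tilde_is_trimmed_triangle)
  have body: "planar_convex_body H_tilde"
    unfolding d(2) by (rule planar_convex_body_trimmed_triangle[OF d(1)])
  have H: "measure lebesgue (trimmed_triangle d) = 1" using d by simp
  have "max_rel_diameter T' \<le> d"
    using max_rel_diameter_trimmed_triangle_le[OF d(1)] H_tilde_center assms(5) unfolding d(2) by blast
  moreover have "d \<le> max_rel_diameter T'"
    by (rule trisection_area_bound(1)[OF body d(3) assms(5) d(1) H])
  ultimately have T': "max_rel_diameter T' = d" by simp
  note T = trisection_area_bound[OF assms(1,3,4) d(1) H]
  show ?thesis
  proof (intro conjI iffI)
    show "max_rel_diameter T' \<le> max_rel_diameter T" using T(1) T' by simp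
    show "\<exists>f. rigid_motion f \<and> C = f ` H_tilde" if "max_rel_diameter T' = max_rel_diameter T"
      using T(2) T' that d(2) by simp
    assume "\<exists>f. rigid_motion f \<and> C = f ` H_tilde"
    then show "max_rel_diameter T' = max_rel_diameter T"
      using max_rel_diameter_rigid_motion[OF _ body assms(5)] assms(1,4) by metis
  qed
qed

end
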